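(* Let $M\subset\mathbb{R}^2$ be an origin-symmetric convex body that is strictly convex, and let $\mathbb{M}$ be the normed plane with unit disk $M$ and norm $\|\cdot\|_M$. Let $p,q\in\mathbb{M}$ with $\|p-q\|_M=1$. Let $f:[0,1]\to\mathbb{M}$ be a continuous curve satisfying the increasing chord property such that $f(0)=p$ and $f(1)=q$. Then the arclength of $f$, measured in the norm $\|\cdot\|_M$, satisfies $$\operatorname{arclength}_M(f)\le \tfrac12\operatorname{perim}_M\big((p+M)\cap(q+M)\big).$$
   Context: A convex body is a compact convex set with nonempty interior. $\|\cdot\|_M$ is the norm on $\mathbb{R}^2$ whose closed unit ball is $M$. A curve $f:[0,1]\to\mathbb{M}$ satisfies the increasing chord property if for all $0\le t_1\le t_2\le t_3\le t_4\le 1$ one has $\|f(t_4)-f(t_1)\|_M\ge\|f(t_3)-f(t_2)\|_M$. The arclength $\operatorname{arclength}_M(f)$ is the supremum of $\sum_{i=1}^n\|f(t_i)-f(t_{i-1})\|_M$ over all subdivisions $0=t_0<t_1<\dots<t_n=1$ of $[0,1]$. For a convex disk $K$ (a compact planar convex set with nonempty interior), $\operatorname{perim}_M(K)$ denotes the arclength, in the norm $\|\cdot\|_M$, of the boundary curve of $K$. *)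

theory Defs
  imports "HOL-Analysis.Analysis"
begin

definition convex_body :: "'a::euclidean_space set \<Rightarrow> bool" where
  "convex_body S \<longleftrightarrow> compact S \<and> convex S \<and> interior S \<noteq> {}"

definition origin_symmetric :: "'a::real_vector set \<Rightarrow> bool" where
  "origin_symmetric S \<longleftrightarrow> uminus ` S = S"

definition strictly_convex :: "'a::euclidean_space set \<Rightarrow> bool" where
  "strictly_convex S \<longleftrightarrow> (\<forall>x\<in>S. \<forall>y\<in>S. x \<noteq> y \<longrightarrow> open_segment x y \<subseteq> interior S)"

(* The Minkowski functional. For an origin-symmetric convex body M it is the norm with closed
   unit ball M; see the five lemmas mnorm_le_iff, mnorm_nonneg, mnorm_eq_0_iff, mnorm_scaleR and
   mnorm_triangle. *)
definition mnorm :: "'a::real_vector set \<Rightarrow> 'a \<Rightarrow> real" where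
  "mnorm M x = Inf {r. 0 < r \<and> x \<in> (\<lambda>v. r *\<^sub>R v) ` M}"

definition increasing_chord :: "'a::real_vector set \<Rightarrow> (real \<Rightarrow> 'a) \<Rightarrow> bool" where
  "increasing_chord M f \<longleftrightarrow>
     (\<forall>t1 t2 t3 t4. 0 \<le> t1 \<and> t1 \<le> t2 \<and> t2 \<le> t3 \<and> t3 \<le> t4 \<and> t4 \<le> 1 \<longrightarrow>
        mnorm M (f t4 - f t1) \<ge> mnorm M (f t3 - f t2))"

definition subdivision :: "nat \<Rightarrow> (nat \<Rightarrow> real) \<Rightarrow> bool" where
  "subdivision n t \<longleftrightarrow> t 0 = 0 \<and> t n = 1 \<and> (\<forall>i<n. t i < t (Suc i))"

(* Extended-real valued, so that non-rectifiable curves have arclength \<infinity>. *)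
definition arclength :: "'a::real_vector set \<Rightarrow> (real \<Rightarrow> 'a) \<Rightarrow> ereal" where
  "arclength M f =
     (SUP (n, t) \<in> {(n, t). subdivision n t}.
        ereal (\<Sum>i=1..n. mnorm M (f (t i) - f (t (i - 1)))))"

definition boundary_curve :: "'a::topological_space set \<Rightarrow> (real \<Rightarrow> 'a) \<Rightarrow> bool" where
  "boundary_curve K g \<longleftrightarrow>
     simple_path g \<and> pathfinish g = pathstart g \<and> path_image g = frontier K"

(* Meant for planar convex bodies K: these have a boundary curve (boundary_curve_exists), and
   the arclength is the same for all of them, so the choice made here is immaterial. *)
definition perim :: "(real^2) set \<Rightarrow> (real^2) set \<Rightarrow> ereal" where
  "perim M K = arclength M (SOME g. boundary_curve K g)"

lemma origin_symmetric_minus: "origin_symmetric M \<Longrightarrow> x \<in> M \<Longrightarrow> - x \<in> M"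
  unfolding origin_symmetric_def by blast

lemma convex_body_0_interior:
  assumes "convex_body M" "origin_symmetric M"
  shows "0 \<in> interior M"
proof -
  obtain x where x: "x \<in> interior M"
    using assms(1) unfolding convex_body_def by blast
  have "- x \<in> uminus ` interior M"
    using x by blast
  also have "uminus ` interior M = interior M"
    using assms(2) interior_negations[of M] unfolding origin_symmetric_def by simp
  finally have "- x \<in> interior M" .
  moreover have "convex (interior M)"
    using assms(1) convex_interior unfolding convex_body_def by blast
  ultimately have "(1/2) *\<^sub>R x + (1/2) *\<^sub>R (- x) \<in> interior M"
    using x by (intro convexD) auto
  then show ?thesis by simp
qed

lemma scaleR_image_iff:
  fixes x :: "'a::real_vector"
  assumes "0 < r"
  shows "x \<in> (\<lambda>v. r *\<^sub>R v) ` M \<longleftrightarrow> (1/r) *\<^sub>R x \<in> M"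
proof
  assume "(1/r) *\<^sub>R x \<in> M"
  then have "r *\<^sub>R ((1/r) *\<^sub>R x) \<in> (\<lambda>v. r *\<^sub>R v) ` M" by blast
  then show "x \<in> (\<lambda>v. r *\<^sub>R v) ` M" using assms by simp
qed (use assms in auto)

lemma mnorm_alt: "mnorm M x = Inf {r. 0 < r \<and> (1/r) *\<^sub>R x \<in> M}"
proof -
  have "{r. 0 < r \<and> x \<in> (\<lambda>v. r *\<^sub>R v) ` M} = {r. 0 < r \<and> (1/r) *\<^sub>R x \<in> M}"
    by (auto simp: scaleR_image_iff)
  then show ?thesis unfolding mnorm_def by simp
qed

lemma mnorm_set_nonempty:
  assumes "convex_body M" "origin_symmetric M"
  shows "\<exists>r>0. (1/r) *\<^sub>R x \<in> M"
proof -
  obtain e where e: "0 < e" "cball 0 e \<subseteq> M"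
    using convex_body_0_interior[OF assms] mem_interior_cball by blast
  define r where "r = (norm x + 1) / e"
  have r: "0 < r" unfolding r_def using e(1) by (simp add: add_nonneg_pos)
  have "norm ((1/r) *\<^sub>R x) = norm x * e / (norm x + 1)"
    using r e(1) unfolding r_def by (simp add: field_simps abs_if)
  also have "\<dots> \<le> e"
    using mult_left_mono[of "norm x / (norm x + 1)" 1 e] e(1)
    by (simp add: divide_le_eq_1 add_nonneg_pos mult.commute)
  finally have "(1/r) *\<^sub>R x \<in> M" using e(2) by (auto simp: subset_iff)
  then show ?thesis using r by blast
qed

lemma mnorm_nonneg:
  assumes "convex_body M" "origin_symmetric M"
  shows "0 \<le> mnorm M x"
  unfolding mnorm_alt using mnorm_set_nonempty[OF assms, of x]
  by (intro cInf_greatest) auto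

lemma mnorm_le_iff:
  assumes M: "convex_body M" "origin_symmetric M" and r: "0 < r"
  shows "mnorm M x \<le> r \<longleftrightarrow> (1/r) *\<^sub>R x \<in> M"
proof
  let ?S = "{s. 0 < s \<and> (1/s) *\<^sub>R x \<in> M}"
  have bdd: "bdd_below ?S" by (rule bdd_belowI[of _ 0]) auto
  show "mnorm M x \<le> r" if "(1/r) *\<^sub>R x \<in> M"
    unfolding mnorm_alt using that r bdd by (intro cInf_lower) auto
  assume le: "mnorm M x \<le> r"
  have zero: "0 \<in> M" using convex_body_0_interior[OF M] interior_subset by blast
  have conv: "convex M" and cl: "closed M"
    using M(1) compact_imp_closed unfolding convex_body_def by blast+
  have ne: "?S \<noteq> {}" using mnorm_set_nonempty[OF M, of x] by blast
  have gt: "(1/s) *\<^sub>R x \<in> M" if s: "r < s" for s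
  proof -
    have "Inf ?S < s" using le s unfolding mnorm_alt by linarith
    then obtain u where u: "0 < u" "(1/u) *\<^sub>R x \<in> M" "u < s"
      using ne bdd by (subst (asm) cInf_less_iff) auto
    have "(1 - u/s) *\<^sub>R 0 + (u/s) *\<^sub>R ((1/u) *\<^sub>R x) \<in> M"
      using u zero conv by (intro convexD) (auto simp: field_simps)
    then show ?thesis using u by simp
  qed
  have lim: "((\<lambda>s. (1/s) *\<^sub>R x) \<longlongrightarrow> (1/r) *\<^sub>R x) (at_right r)"
    using r by (intro tendsto_intros) auto
  have ev: "eventually (\<lambda>s. (1/s) *\<^sub>R x \<in> M) (at_right r)"
    by (auto simp: eventually_at_filter gt)
  show "(1/r) *\<^sub>R x \<in> M"
    by (rule Lim_in_closed_set[OF cl ev _ lim]) simp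
qed

lemma mnorm_eq_0_iff:
  assumes M: "convex_body M" "origin_symmetric M"
  shows "mnorm M x = 0 \<longleftrightarrow> x = 0"
proof
  have zero: "0 \<in> M" using convex_body_0_interior[OF M] interior_subset by blast
  show "mnorm M x = 0" if "x = 0"
  proof -
    have "mnorm M x \<le> r" if "0 < r" for r
      using that \<open>x = 0\<close> zero by (simp add: mnorm_le_iff[OF M])
    then have "mnorm M x \<le> 0" using field_le_epsilon[of "mnorm M x" 0] by simp
    then show ?thesis using mnorm_nonneg[OF M, of x] by simp
  qed
  assume z: "mnorm M x = 0"
  have "bounded M" using M(1) compact_imp_bounded unfolding convex_body_def by blast
  then obtain b where b: "0 < b" "\<And>y. y \<in> M \<Longrightarrow> norm y \<le> b"
    unfolding bounded_pos by blast
  have "norm x \<le> 0 + e" if "0 < e" for e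
  proof -
    have "(1/(e/b)) *\<^sub>R x \<in> M"
      using mnorm_le_iff[OF M, of "e/b" x] z that b(1) by simp
    then have "norm ((1/(e/b)) *\<^sub>R x) \<le> b" by (rule b(2))
    then have "b * norm x \<le> b * e"
      using that b(1) by (simp add: pos_divide_le_eq abs_of_pos)
    then have "norm x \<le> e" using b(1) by simp
    then show ?thesis by simp
  qed
  then show "x = 0" using field_le_epsilon[of "norm x" 0] by simp
qed

lemma mnorm_minus:
  assumes "origin_symmetric M"
  shows "mnorm M (- x) = mnorm M x"
proof -
  have "(1/r) *\<^sub>R (- x) \<in> M \<longleftrightarrow> (1/r) *\<^sub>R x \<in> M" for r :: real
    using origin_symmetric_minus[OF assms, of "(1/r) *\<^sub>R x"]
      origin_symmetric_minus[OF assms, of "(1/r) *\<^sub>R (- x)"] by auto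
  then show ?thesis unfolding mnorm_alt by simp
qed

lemma mnorm_scaleR:
  assumes M: "convex_body M" "origin_symmetric M"
  shows "mnorm M (c *\<^sub>R x) = \<bar>c\<bar> * mnorm M x"
proof -
  have pos_le: "mnorm M (c *\<^sub>R x) \<le> c * mnorm M x" if "0 < c" for c and x :: 'a
  proof (rule field_le_epsilon)
    fix e :: real assume e: "0 < e"
    define r where "r = mnorm M x + e / c"
    have r: "0 < r" unfolding r_def using e that mnorm_nonneg[OF M, of x]
      by (simp add: add_nonneg_pos)
    have "mnorm M x \<le> r" unfolding r_def using e that by simp
    then have "(1/r) *\<^sub>R x \<in> M" using mnorm_le_iff[OF M r] by blast
    then have "(1/(c*r)) *\<^sub>R (c *\<^sub>R x) \<in> M" using that by simp
    then have "mnorm M (c *\<^sub>R x) \<le> c * r"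
      using mnorm_le_iff[OF M, of "c*r"] r that by simp
    then show "mnorm M (c *\<^sub>R x) \<le> c * mnorm M x + e"
      unfolding r_def using that by (simp add: distrib_left)
  qed
  have pos: "mnorm M (c *\<^sub>R x) = c * mnorm M x" if c: "0 < c" for c and x :: 'a
  proof (rule antisym[OF pos_le[OF c]])
    have "mnorm M ((1/c) *\<^sub>R (c *\<^sub>R x)) \<le> (1/c) * mnorm M (c *\<^sub>R x)"
      using c by (intro pos_le) simp
    then show "c * mnorm M x \<le> mnorm M (c *\<^sub>R x)" using c by (simp add: field_simps)
  qed
  consider "c = 0" | "0 < c" | "0 < - c" by linarith
  then show ?thesis
  proof cases
    case 1 then show ?thesis using mnorm_eq_0_iff[OF M, of 0] by simp
  next
    case 2 then show ?thesis using pos by simp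
  next
    case 3
    then show ?thesis using pos[OF 3, of x] mnorm_minus[OF M(2), of "c *\<^sub>R x"] by simp
  qed
qed

lemma mnorm_triangle:
  assumes M: "convex_body M" "origin_symmetric M"
  shows "mnorm M (x + y) \<le> mnorm M x + mnorm M y"
proof (rule field_le_epsilon)
  fix e :: real assume e: "0 < e"
  define r where "r = mnorm M x + e/2"
  define s where "s = mnorm M y + e/2"
  have rs: "0 < r" "0 < s" unfolding r_def s_def using e mnorm_nonneg[OF M]
    by (simp_all add: add_nonneg_pos)
  have "(1/r) *\<^sub>R x \<in> M" "(1/s) *\<^sub>R y \<in> M"
    using mnorm_le_iff[OF M rs(1), of x] mnorm_le_iff[OF M rs(2), of y] e
    unfolding r_def s_def by auto
  then have "(r/(r+s)) *\<^sub>R ((1/r) *\<^sub>R x) + (s/(r+s)) *\<^sub>R ((1/s) *\<^sub>R y) \<in> M"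
    using rs M(1) unfolding convex_body_def
    by (intro convexD) (auto simp: add_divide_distrib[symmetric])
  then have "(1/(r+s)) *\<^sub>R (x + y) \<in> M"
    using rs by (simp add: scaleR_add_right)
  then have "mnorm M (x + y) \<le> r + s"
    using mnorm_le_iff[OF M, of "r+s"] rs by simp
  then show "mnorm M (x + y) \<le> mnorm M x + mnorm M y + e"
    unfolding r_def s_def by simp
qed

lemma boundary_curve_exists:
  fixes K :: "(real^2) set"
  assumes K: "convex_body K"
  shows "\<exists>g. boundary_curve K g"
proof -
  have "frontier K homeomorphic frontier (cball (0::complex) 1)"
  proof (rule homeomorphic_frontiers_same_dimension)
    have "aff_dim K = aff_dim (cball (0::complex) 1)"
      using K by (simp add: convex_body_def aff_dim_nonempty_interior aff_dim_cball)
    then show "K homeomorphic cball (0::complex) 1"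
      using K by (simp add: convex_body_def homeomorphic_convex_compact_sets)
    show "closed K"
      using K compact_imp_closed by (auto simp: convex_body_def)
  qed simp_all
  then have "sphere (0::complex) 1 homeomorphic frontier K"
    by (subst homeomorphic_sym) simp
  then obtain h k where hk: "homeomorphism (sphere (0::complex) 1) (frontier K) h k"
    unfolding homeomorphic_def by blast
  let ?c = "\<lambda>t::real. cis (2 * pi * t)"
  have inj: "x = y \<or> x = 0 \<and> y = 1 \<or> x = 1 \<and> y = 0"
    if "x \<in> {0..1}" "y \<in> {0..1}" "h (?c x) = h (?c y)" for x y
  proof -
    have "k (h (?c x)) = k (h (?c y))" using that by simp
    then have "?c x = ?c y" using hk by (simp add: homeomorphism_def)
    then have "cis (2 * pi * (x - y)) = 1"
      by (simp add: right_diff_distrib cis_divide[symmetric])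
    then have "cos (2 * pi * (x - y)) = 1" by (simp add: complex_eq_iff)
    then obtain n :: int where "2 * pi * (x - y) = real_of_int n * 2 * pi"
      using cos_one_2pi_int by auto
    then have "x - y = real_of_int n" by simp
    moreover have "-1 \<le> x - y" "x - y \<le> 1" using that by auto
    ultimately have "n = -1 \<or> n = 0 \<or> n = 1" by linarith
    then show ?thesis using \<open>x - y = real_of_int n\<close> that by auto
  qed
  have cim: "?c ` {0..1} = sphere 0 1"
  proof
    show "sphere 0 1 \<subseteq> ?c ` {0..1}"
    proof
      fix z :: complex assume "z \<in> sphere 0 1"
      then have "norm z = 1" by simp
      then obtain t where t: "0 \<le> t" "t < 2 * pi" "z = cis t"
        by (rule complex_unimodular_polar) (simp add: complex_eq_iff)
      then have "z = ?c (t / (2*pi))" "t / (2*pi) \<in> {0..1}" by auto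
      then show "z \<in> ?c ` {0..1}" by blast
    qed
  qed auto
  have "continuous_on {0..1} (h \<circ> ?c)"
    using hk cim unfolding homeomorphism_def
    by (intro continuous_on_compose) (auto intro!: continuous_intros)
  moreover have "(h \<circ> ?c) ` {0..1} = frontier K"
    using hk cim unfolding homeomorphism_def by (metis image_comp)
  ultimately have "boundary_curve K (h \<circ> ?c)"
    unfolding boundary_curve_def simple_path_def loop_free_def path_def path_image_def
      pathstart_def pathfinish_def
    using inj by simp
  then show ?thesis by blast
qed

end

theory Submission
  imports Defs
begin

text \<open>
  Write \<open>N\<close> for the norm with unit disk \<open>M\<close> and \<open>e = q - p\<close>, so that \<open>N e = 1\<close>.

  Length becomes a question about linear functionals by a finite form of Crofton's formula: in the
  plane, every finite set of vectors admits finitely many linear \<open>\<psi> k\<close> such that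
  \<open>\<Sum>k. \<bar>\<psi> k y\<bar> \<le> N y\<close> always holds and is an equality on the given vectors
  (\<open>finite_Crofton\<close>). Taking the edges of an inscribed polygon of \<open>f\<close> as these vectors, the
  length of the polygon is the sum of the variations of \<open>f\<close> under the functionals. On the other
  side, a closed curve that runs through the boundary of the lens \<open>K = (p + M) \<inter> (q + M)\<close> has under
  each \<open>\<psi> k\<close> a variation of at least twice the width of \<open>K\<close>, so its length is at least the sum of
  these double widths (\<open>widths_le_perim\<close>). It remains to see that, under every functional \<open>\<psi>\<close>, an
  inscribed polygon of \<open>f\<close> varies by at most the width of \<open>K\<close>. If \<open>x\<close> is the sum of the edges on
  which \<open>\<psi>\<close> is nonnegative, this variation is \<open>\<psi> ((p + x) - (q - x))\<close>, and both \<open>p + x\<close> and \<open>q - x\<close>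
  lie in \<open>K\<close> once \<open>N x \<le> 1\<close> and \<open>N (e - x) \<le> 1\<close>.

  So the heart is the inequality \<open>N x \<le> 1\<close> for every \<open>x\<close> that is a sum of chords of \<open>f\<close> over
  successive time intervals (\<open>N_rise_le_1\<close>; the complement \<open>e - x\<close> is again such a sum). For a fixed
  number of intervals these sums form a compact set. Suppose that it leaves the unit disk, and maximise
  over it the norm plus a small multiple of a functional norming \<open>e\<close>. The maximiser \<open>x\<close> also
  maximises some linear \<open>\<psi>\<close>, and then the end points of the intervals of \<open>x\<close> are local extrema of
  \<open>\<psi> \<circ> f\<close> or end points of \<open>f\<close>. Close to such an extremum \<open>f\<close> has short chords
  parallel to the kernel of \<open>\<psi>\<close>; comparing
  these with long chords by the increasing chord property shows that the norm does not decrease when one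
  starts from a long chord at the extremum and moves in the kernel direction \<open>w\<close> that points along \<open>f\<close>
  (\<open>local_max_passes\<close>). The vectors from which the norm does not decrease in direction \<open>w\<close> form a half
  plane, by strict convexity and because the dimension is two (\<open>grows_half_plane\<close>). Half planes are
  closed under addition, so the property passes from the single chords to \<open>x\<close> and \<open>e - x\<close>
  (\<open>maximal_rise_grows\<close>). But the functional was chosen so that, outside the unit disk, the norm does
  decrease from \<open>x\<close> along its kernel towards \<open>e\<close>: this is the contradiction.
\<close>

section \<open>Linear functionals on the plane\<close>

definition cross2 :: "real^2 \<Rightarrow> real^2 \<Rightarrow> real" where
  "cross2 x y = x$1 * y$2 - x$2 * y$1"

text \<open>Cramer's rule, in a form without division that also covers dependent \<open>x\<close> and \<open>y\<close>.\<close>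
lemma cross2_expand: "cross2 x y *\<^sub>R z = cross2 z y *\<^sub>R x + cross2 x z *\<^sub>R y"
  by (simp add: vec_eq_iff forall_2 cross2_def algebra_simps)

lemma linear_cross2_left: "linear (\<lambda>x. cross2 x y)"
  and linear_cross2_right: "linear (cross2 x)"
  by (auto intro!: linearI simp: cross2_def algebra_simps)

lemma cross2_self [simp]: "cross2 x x = 0"
  by (simp add: cross2_def)

lemma cross2_skew: "cross2 x y = - cross2 y x"
  by (simp add: cross2_def)

lemma cross2_rotate_pos:
  assumes "w \<noteq> 0"
  obtains y where "0 < cross2 w y"
proof
  show "0 < cross2 w (vector [- w$2, w$1])"
    using assms by (auto simp: cross2_def vec_eq_iff forall_2 sum_squares_gt_zero_iff
        power2_eq_square[symmetric] add_pos_nonneg add_nonneg_pos)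
qed

lemma linear_kernel_line:
  fixes \<psi> :: "real^2 \<Rightarrow> real"
  assumes lin: "linear \<psi>" and u: "\<psi> u \<noteq> 0" and w: "w \<noteq> 0" "\<psi> w = 0" and z: "\<psi> z = 0"
  obtains c where "z = c *\<^sub>R w"
proof -
  have "cross2 w z * \<psi> u = 0"
    using arg_cong[OF cross2_expand[of w z u], of \<psi>] w z
    by (simp add: linear_add[OF lin] linear_scale[OF lin])
  then have wz: "cross2 w z = 0" using u by simp
  obtain y where y: "0 < cross2 w y" using cross2_rotate_pos[OF w(1)] .
  have "cross2 w y *\<^sub>R z = cross2 z y *\<^sub>R w"
    using cross2_expand[of w y z] wz by simp
  then have "z = (cross2 z y / cross2 w y) *\<^sub>R w"
    using y by (metis divideR_right divide_inverse_commute less_irrefl scaleR_scaleR)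
  then show thesis by (rule that)
qed

section \<open>Strictly convex norms on the plane\<close>

locale strictly_convex_norm =
  fixes N :: "real^2 \<Rightarrow> real"
  assumes N_zero_iff: "N x = 0 \<longleftrightarrow> x = 0"
    and N_scale: "N (c *\<^sub>R x) = \<bar>c\<bar> * N x"
    and N_triangle: "N (x + y) \<le> N x + N y"
    and N_strict: "N x \<le> 1 \<Longrightarrow> N y \<le> 1 \<Longrightarrow> x \<noteq> y \<Longrightarrow> N (x + y) < 2"
begin

lemma N_0 [simp]: "N 0 = 0"
  by (simp add: N_zero_iff)

lemma N_minus [simp]: "N (- x) = N x"
  using N_scale[of "-1" x] by simp

lemma N_minus_commute: "N (x - y) = N (y - x)"
  using N_minus[of "x - y"] by simp

lemma N_nonneg [simp]: "0 \<le> N x"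
  using N_triangle[of x "- x"] by simp

lemma N_pos: "x \<noteq> 0 \<Longrightarrow> 0 < N x"
  using N_nonneg[of x] N_zero_iff[of x] by linarith

lemma N_triangle_diff: "N x \<le> N y + N (x - y)"
  using N_triangle[of y "x - y"] by simp

lemma N_convex_on: "convex_on S N" if "convex S"
proof (rule convex_onI)
  fix t :: real and x y assume "0 < t" "t < 1"
  then show "N ((1 - t) *\<^sub>R x + t *\<^sub>R y) \<le> (1 - t) * N x + t * N y"
    using N_triangle[of "(1 - t) *\<^sub>R x" "t *\<^sub>R y"] by (simp add: N_scale)
qed (rule that)

lemma continuous_on_N [continuous_intros]:
  assumes "continuous_on S g"
  shows "continuous_on S (\<lambda>x. N (g x))"
proof -
  have "continuous_on UNIV N"
    by (rule convex_on_continuous) (auto intro: N_convex_on)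
  then show ?thesis
    using continuous_on_compose2[OF _ assms] by blast
qed

text \<open>By convexity, a norm that has not decreased after some way along a ray will not fall below its
  initial value any more.\<close>
lemma N_ray_mono:
  assumes "N x \<le> N (x + h *\<^sub>R w)" and "0 < h" and "h \<le> k"
  shows "N x \<le> N (x + k *\<^sub>R w)"
proof -
  have "x + h *\<^sub>R w = (1 - h/k) *\<^sub>R x + (h/k) *\<^sub>R (x + k *\<^sub>R w)"
    using assms by (simp add: algebra_simps)
  then have "N (x + h *\<^sub>R w) \<le> N ((1 - h/k) *\<^sub>R x) + N ((h/k) *\<^sub>R (x + k *\<^sub>R w))"
    using N_triangle by simp
  also have "\<dots> = (1 - h/k) * N x + (h/k) * N (x + k *\<^sub>R w)"
    using assms by (simp add: N_scale)
  finally have "(h/k) * N x \<le> (h/k) * N (x + k *\<^sub>R w)"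
    using assms(1) by (simp add: algebra_simps)
  then show ?thesis
    using assms by (simp add: mult_le_cancel_left divide_simps split: if_splits)
qed

text \<open>In the Euclidean plane this says that the angle between \<open>w\<close> and \<open>x\<close> is at most a right angle.\<close>
definition grows :: "real^2 \<Rightarrow> real^2 \<Rightarrow> bool" where
  "grows w x \<longleftrightarrow> (\<forall>s\<ge>0. N x \<le> N (x + s *\<^sub>R w))"

text \<open>A nearest point to the origin on a line parallel to \<open>w\<close>. Its direction plays the role of the
  normal to \<open>w\<close>.\<close>
lemma Birkhoff_orthogonal_exists:
  assumes w: "w \<noteq> 0"
  obtains n where "0 < cross2 w n" and "\<And>s. N n \<le> N (n + s *\<^sub>R w)"
proof -
  obtain y where y: "0 < cross2 w y" using cross2_rotate_pos[OF w] .
  define S where "S = 2 * N y / N w"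
  have Nw: "0 < N w" using w by (rule N_pos)
  have S: "0 \<le> S" using Nw by (simp add: S_def)
  have "continuous_on {-S..S} (\<lambda>s. N (y + s *\<^sub>R w))"
    by (intro continuous_intros)
  then have "\<exists>s0\<in>{-S..S}. \<forall>s\<in>{-S..S}. N (y + s0 *\<^sub>R w) \<le> N (y + s *\<^sub>R w)"
    using S by (intro continuous_attains_inf) auto
  then obtain s0 where s0: "\<And>s. s \<in> {-S..S} \<Longrightarrow> N (y + s0 *\<^sub>R w) \<le> N (y + s *\<^sub>R w)"
    by blast
  have min: "N (y + s0 *\<^sub>R w) \<le> N (y + s *\<^sub>R w)" for s
  proof (cases "s \<in> {-S..S}")
    case False
    then have "S < \<bar>s\<bar>" by auto
    then have "2 * N y < \<bar>s\<bar> * N w"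
      using Nw by (simp add: S_def divide_simps)
    also have "\<bar>s\<bar> * N w \<le> N (y + s *\<^sub>R w) + N y"
      using N_triangle[of "y + s *\<^sub>R w" "- y"] by (simp add: N_scale)
    finally have "N (y + 0 *\<^sub>R w) \<le> N (y + s *\<^sub>R w)" by simp
    then show ?thesis using s0[of 0] S by simp
  qed (rule s0)
  show thesis
  proof
    show "0 < cross2 w (y + s0 *\<^sub>R w)"
      using y by (simp add: linear_add[OF linear_cross2_right] linear_scale[OF linear_cross2_right])
    show "N (y + s0 *\<^sub>R w) \<le> N (y + s0 *\<^sub>R w + s *\<^sub>R w)" for s
      using min[of "s0 + s"] by (simp add: algebra_simps)
  qed
qed

text \<open>Strict convexity makes the nearest point of each line parallel to \<open>w\<close> unique, and in the plane
  these nearest points form one line. On one side of that line the norm increases in direction \<open>w\<close>, on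
  the other side it first decreases. Without strict convexity the nearest points may fill segments, and
  the region need not be convex. Linearity of the boundary is what makes it possible to add up chords
  later.\<close>
lemma grows_half_plane:
  assumes w: "w \<noteq> 0"
  obtains L :: "real^2 \<Rightarrow> real" where "linear L" and "0 < L w"
    and "\<And>x. grows w x \<longleftrightarrow> 0 \<le> L x" and "\<And>x. grows (- w) x \<longleftrightarrow> L x \<le> 0"
proof -
  obtain n where n: "0 < cross2 w n" and min: "\<And>s. N n \<le> N (n + s *\<^sub>R w)"
    using Birkhoff_orthogonal_exists[OF w] by blast
  have unique: "N (a *\<^sub>R n) < N (a *\<^sub>R n + s *\<^sub>R w)" if s: "s \<noteq> 0" for a s
  proof (cases "a = 0")
    case True
    then show ?thesis using s w N_pos[of "s *\<^sub>R w"] by simp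
  next
    case False
    have n0: "n \<noteq> 0" using n by (auto simp: cross2_def)
    have Nn: "0 < N n" using n0 by (rule N_pos)
    define t where "t = s / a"
    have t: "t \<noteq> 0" using s False by (simp add: t_def)
    have "N n < N (n + t *\<^sub>R w)"
    proof (rule ccontr)
      assume "\<not> ?thesis"
      then have le: "N (n + t *\<^sub>R w) \<le> N n" by simp
      let ?c = "1 / N n"
      have "N (?c *\<^sub>R n + ?c *\<^sub>R (n + t *\<^sub>R w)) < 2"
      proof (rule N_strict)
        show "?c *\<^sub>R n \<noteq> ?c *\<^sub>R (n + t *\<^sub>R w)" using t w Nn by simp
      qed (use Nn le in \<open>simp_all add: N_scale divide_simps\<close>)
      moreover have "?c *\<^sub>R n + ?c *\<^sub>R (n + t *\<^sub>R w) = (2 * ?c) *\<^sub>R (n + (t/2) *\<^sub>R w)"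
        by (simp add: vec_eq_iff algebra_simps)
      ultimately have "N (n + (t/2) *\<^sub>R w) < N n"
        using Nn by (simp add: N_scale divide_simps)
      then show False using min[of "t/2"] by simp
    qed
    then have "\<bar>a\<bar> * N n < \<bar>a\<bar> * N (n + t *\<^sub>R w)"
      using False by simp
    then show ?thesis
      using False by (simp add: N_scale[symmetric] scaleR_add_right t_def)
  qed
  define L where "L x = cross2 x n / cross2 w n" for x
  have lin: "linear L"
    unfolding L_def by (auto intro!: linearI simp: cross2_def algebra_simps add_divide_distrib diff_divide_distrib)
  define \<alpha> where "\<alpha> x = cross2 w x / cross2 w n" for x
  have decomp: "x = \<alpha> x *\<^sub>R n + L x *\<^sub>R w" for x
  proof -
    have "cross2 w n *\<^sub>R x = cross2 w n *\<^sub>R (\<alpha> x *\<^sub>R n + L x *\<^sub>R w)"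
      using cross2_expand[of w n x] n by (simp add: \<alpha>_def L_def scaleR_add_right)
    then show ?thesis using n by simp
  qed
  \<comment> \<open>The norm along the line through \<open>x\<close> in direction \<open>w\<close> is least only at \<open>\<alpha> x *\<^sub>R n\<close>, so by
    convexity it grows exactly when one moves away from there. The factor \<open>c\<close> treats \<open>w\<close> and \<open>- w\<close> alike.\<close>
  have away: "grows (c *\<^sub>R w) x \<longleftrightarrow> 0 \<le> c * L x" if c: "c \<noteq> 0" for c x
  proof
    assume g: "grows (c *\<^sub>R w) x"
    show "0 \<le> c * L x"
    proof (rule ccontr)
      assume neg: "\<not> ?thesis"
      then have l: "L x \<noteq> 0" by auto
      have "0 \<le> - L x / c"
        using neg c by (auto simp: mult_less_0_iff divide_le_0_iff not_le)
      then have "N x \<le> N (x + (- L x / c) *\<^sub>R (c *\<^sub>R w))"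
        using g unfolding grows_def by blast
      also have "x + (- L x / c) *\<^sub>R (c *\<^sub>R w) = \<alpha> x *\<^sub>R n"
        using decomp[of x] c by (simp add: algebra_simps)
      finally show False
        using unique[OF l, of "\<alpha> x"] decomp[of x] by simp
    qed
  next
    assume pos: "0 \<le> c * L x"
    show "grows (c *\<^sub>R w) x"
      unfolding grows_def
    proof (intro allI impI)
      fix s :: real assume s: "0 \<le> s"
      let ?m = "\<alpha> x *\<^sub>R n"
      show "N x \<le> N (x + s *\<^sub>R c *\<^sub>R w)"
      proof (cases "s = 0 \<or> L x = 0")
        case True
        then show ?thesis
          using unique[of "s * c" "\<alpha> x"] decomp[of x] c by (cases "s = 0") auto
      next
        case False
        define h where "h = s * c / L x"
        have h: "0 < h"
          using False s pos c unfolding h_def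
          by (auto simp: zero_less_divide_iff zero_le_mult_iff mult_less_0_iff zero_less_mult_iff)
        define k where "k = 1 / (1 + h)"
        have k: "0 \<le> k" "k \<le> 1" using h by (auto simp: k_def)
        have x_mid: "x = (1 - k) *\<^sub>R ?m + k *\<^sub>R (x + s *\<^sub>R c *\<^sub>R w)"
        proof -
          have "s *\<^sub>R c *\<^sub>R w = (h * L x) *\<^sub>R w" using False by (simp add: h_def)
          then have "x + s *\<^sub>R c *\<^sub>R w = (?m + L x *\<^sub>R w) + (h * L x) *\<^sub>R w"
            by (simp only: decomp[of x, symmetric])
          then have 1: "x + s *\<^sub>R c *\<^sub>R w = ?m + ((1 + h) * L x) *\<^sub>R w"
            by (simp add: algebra_simps)
          have 2: "k * ((1 + h) * L x) = L x"
            using h by (simp add: k_def)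
          have "(1 - k) *\<^sub>R ?m + k *\<^sub>R (x + s *\<^sub>R c *\<^sub>R w) = (1 - k) *\<^sub>R ?m + k *\<^sub>R ?m + L x *\<^sub>R w"
            by (subst 1) (simp only: scaleR_add_right scaleR_scaleR 2 add.assoc)
          also have "\<dots> = ?m + L x *\<^sub>R w" by (simp add: algebra_simps)
          finally show ?thesis using decomp[of x] by simp
        qed
        have "N x \<le> N ((1 - k) *\<^sub>R ?m) + N (k *\<^sub>R (x + s *\<^sub>R c *\<^sub>R w))"
          by (subst x_mid) (rule N_triangle)
        also have "\<dots> = (1 - k) * N ?m + k * N (x + s *\<^sub>R c *\<^sub>R w)"
          using k by (simp add: N_scale del: scaleR_scaleR)
        also have "\<dots> \<le> (1 - k) * N x + k * N (x + s *\<^sub>R c *\<^sub>R w)"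
          using unique[of "L x" "\<alpha> x"] decomp[of x] False k
          by (intro add_right_mono mult_left_mono) auto
        finally have "k * N x \<le> k * N (x + s *\<^sub>R c *\<^sub>R w)" by (simp add: algebra_simps)
        then show ?thesis using h by (simp add: k_def mult_le_cancel_left divide_simps split: if_splits)
      qed
    qed
  qed
  show thesis
  proof
    show "linear L" by (rule lin)
    show "0 < L w" using n by (simp add: L_def)
    show "grows w x \<longleftrightarrow> 0 \<le> L x" for x using away[of 1 x] by simp
    show "grows (- w) x \<longleftrightarrow> L x \<le> 0" for x using away[of "-1" x] by simp
  qed
qed

text \<open>At a point where the unit circle has a corner there are many norming functionals. Among those at
  \<open>x\<close>, the one found here takes the largest possible value at \<open>e\<close>: its value there is the right
  derivative of the norm at \<open>x\<close> in direction \<open>e\<close>, which the last property expresses. It is defined by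
  its values at \<open>x\<close> and \<open>e\<close>.\<close>
lemma directional_norming_functional:
  assumes xe: "cross2 x e \<noteq> 0"
  obtains \<phi> :: "real^2 \<Rightarrow> real" where "linear \<phi>" and "\<phi> x = N x" and "\<And>z. \<phi> z \<le> N z"
    and "\<And>\<delta>. 0 < \<delta> \<Longrightarrow> \<exists>s>0. N (x + s *\<^sub>R e) < N x + s * (\<phi> e + \<delta>)"
proof -
  define Q where "Q = (\<lambda>s. (N (x + s *\<^sub>R e) - N x) / s) ` {0<..}"
  define D where "D = Inf Q"
  have lower: "(N x - N (x - r *\<^sub>R e)) / r \<le> (N (x + s *\<^sub>R e) - N x) / s" if "0 < r" "0 < s" for r s
  proof -
    have "(r + s) *\<^sub>R x = s *\<^sub>R (x - r *\<^sub>R e) + r *\<^sub>R (x + s *\<^sub>R e)"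
      by (simp add: algebra_simps)
    then have "N ((r + s) *\<^sub>R x) \<le> N (s *\<^sub>R (x - r *\<^sub>R e)) + N (r *\<^sub>R (x + s *\<^sub>R e))"
      using N_triangle by metis
    then have "(r + s) * N x \<le> s * N (x - r *\<^sub>R e) + r * N (x + s *\<^sub>R e)"
      using that by (simp add: N_scale)
    then show ?thesis
      using that by (simp add: divide_simps algebra_simps)
  qed
  have bdd: "bdd_below Q"
    using lower[of 1] by (intro bdd_belowI[of _ "N x - N (x - e)"]) (auto simp: Q_def)
  have ne: "Q \<noteq> {}" by (simp add: Q_def)
  \<comment> \<open>The tangent at \<open>x\<close> supports the norm along the whole line, also backwards.\<close>
  have half: "N x + s * D \<le> N (x + s *\<^sub>R e)" for s
  proof -
    consider "s = 0" | "0 < s" | "0 < - s" by linarith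
    then show ?thesis
    proof cases
      case 2
      then have "D \<le> (N (x + s *\<^sub>R e) - N x) / s"
        unfolding D_def by (intro cInf_lower bdd) (auto simp: Q_def)
      then show ?thesis using 2 by (simp add: field_simps)
    next
      case 3
      then have "(N x - N (x - (- s) *\<^sub>R e)) / (- s) \<le> D"
        unfolding D_def using lower[of "- s"] by (intro cInf_greatest ne) (auto simp: Q_def)
      then show ?thesis using 3 by (simp add: field_simps)
    qed simp
  qed
  define \<phi> where "\<phi> z = (cross2 z e * N x + cross2 x z * D) / cross2 x e" for z
  have lin: "linear \<phi>"
    using xe unfolding \<phi>_def
    by (intro linearI) (simp_all add: field_simps linear_add[OF linear_cross2_right]
        linear_add[OF linear_cross2_left] linear_scale[OF linear_cross2_right]
        linear_scale[OF linear_cross2_left])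
  have \<phi>x: "\<phi> x = N x" and \<phi>e: "\<phi> e = D" using xe by (simp_all add: \<phi>_def)
  have pos: "\<phi> z \<le> N z" if z: "0 < cross2 z e / cross2 x e" for z
  proof -
    let ?a = "cross2 z e / cross2 x e" and ?s = "cross2 x z / cross2 z e"
    have "z = ?a *\<^sub>R x + (cross2 x z / cross2 x e) *\<^sub>R e"
    proof -
      have "z = (1 / cross2 x e) *\<^sub>R (cross2 x e *\<^sub>R z)" using xe by simp
      then show ?thesis unfolding cross2_expand[of x e z] by (simp add: scaleR_add_right)
    qed
    also have "\<dots> = ?a *\<^sub>R (x + ?s *\<^sub>R e)"
      using z by (cases "cross2 z e = 0") (simp_all add: scaleR_add_right)
    finally have zz: "z = ?a *\<^sub>R (x + ?s *\<^sub>R e)" .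
    have "\<phi> z = ?a * (N x + ?s * D)"
      by (subst zz) (simp add: linear_scale[OF lin] linear_add[OF lin] \<phi>x \<phi>e)
    also have "\<dots> \<le> ?a * N (x + ?s *\<^sub>R e)"
      using z half[of ?s] by (intro mult_left_mono) auto
    also have "\<dots> = N (?a *\<^sub>R (x + ?s *\<^sub>R e))"
      by (simp only: N_scale abs_of_pos[OF z])
    also have "\<dots> = N z"
      by (rule arg_cong[OF zz[symmetric]])
    finally show ?thesis .
  qed
  \<comment> \<open>Adding a large multiple of \<open>x\<close> moves any point into the half plane treated above, and costs the
    same on both sides.\<close>
  have le: "\<phi> z \<le> N z" for z
  proof -
    define K where "K = 1 + \<bar>cross2 z e / cross2 x e\<bar>"
    have "cross2 (z + K *\<^sub>R x) e / cross2 x e = cross2 z e / cross2 x e + K"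
      using xe by (simp add: linear_add[OF linear_cross2_left] linear_scale[OF linear_cross2_left]
          add_divide_distrib)
    moreover have "0 < cross2 z e / cross2 x e + K" unfolding K_def by linarith
    ultimately have "\<phi> (z + K *\<^sub>R x) \<le> N (z + K *\<^sub>R x)"
      by (intro pos) simp
    also have "\<dots> \<le> N z + K * N x"
      using N_triangle[of z "K *\<^sub>R x"] by (simp add: N_scale K_def)
    finally show ?thesis by (simp add: linear_add[OF lin] linear_scale[OF lin] \<phi>x)
  qed
  show thesis
  proof (rule that[OF lin \<phi>x le])
    fix \<delta> :: real assume "0 < \<delta>"
    then obtain s where s: "0 < s" "(N (x + s *\<^sub>R e) - N x) / s < D + \<delta>"
      using cInf_less_iff[OF ne bdd, of "D + \<delta>"] by (auto simp: Q_def D_def)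
    then have "N (x + s *\<^sub>R e) < N x + s * (\<phi> e + \<delta>)"
      using \<phi>e by (simp add: field_simps)
    then show "\<exists>s>0. N (x + s *\<^sub>R e) < N x + s * (\<phi> e + \<delta>)" using s(1) by blast
  qed
qed

lemma norming_functional:
  assumes "x \<noteq> 0"
  obtains \<phi> :: "real^2 \<Rightarrow> real" where "linear \<phi>" and "\<phi> x = N x" and "\<And>z. \<phi> z \<le> N z"
proof -
  obtain y where "0 < cross2 x y" using cross2_rotate_pos[OF assms] .
  then show thesis
    using directional_norming_functional[of x y] that by (metis less_irrefl)
qed

end

section \<open>Curves with increasing chords at an extremum of a functional\<close>

locale unit_increasing_chord_curve = strictly_convex_norm N for N +
  fixes f :: "real \<Rightarrow> real^2" and e :: "real^2"
  assumes cont: "continuous_on {0..1} f"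
    and chord: "0 \<le> t1 \<Longrightarrow> t1 \<le> t2 \<Longrightarrow> t2 \<le> t3 \<Longrightarrow> t3 \<le> t4 \<Longrightarrow> t4 \<le> 1 \<Longrightarrow>
        N (f t3 - f t2) \<le> N (f t4 - f t1)"
    and e_eq: "e = f 1 - f 0"
    and Ne: "N e = 1"
begin

lemma constant_between:
  assumes "0 \<le> a" "a \<le> t" "t \<le> b" "b \<le> 1" "f a = f b"
  shows "f t = f a"
  using chord[of a a t b] assms N_pos[of "f t - f a"] by (cases "f t = f a") auto

lemma near_point:
  assumes "a \<in> {0..1}" "r \<in> {0..1}" "f a \<noteq> f r" "0 < \<eta>"
  obtains t where "t \<in> closed_segment a r" "0 < N (f t - f r)" "N (f t - f r) < \<eta>"
proof -
  define y where "y = min (\<eta>/2) (N (f a - f r))"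
  have pos: "0 < N (f a - f r)" using assms by (intro N_pos) simp
  have sub: "closed_segment a r \<subseteq> {0..1}"
    using assms by (auto simp: closed_segment_eq_real_ivl split: if_splits)
  have "continuous_on (closed_segment a r) (\<lambda>t. N (f t - f r))"
    by (intro continuous_intros continuous_on_subset[OF cont sub])
  then have "connected ((\<lambda>t. N (f t - f r)) ` closed_segment a r)"
    by (intro connected_continuous_image) auto
  moreover have "0 \<in> (\<lambda>t. N (f t - f r)) ` closed_segment a r"
    by (rule image_eqI[of _ _ r]) auto
  moreover have "N (f a - f r) \<in> (\<lambda>t. N (f t - f r)) ` closed_segment a r"
    by (rule imageI) auto
  moreover have "0 \<le> y" "y \<le> N (f a - f r)" using pos assms by (auto simp: y_def)
  ultimately have "y \<in> (\<lambda>t. N (f t - f r)) ` closed_segment a r"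
    by (rule connectedD_interval)
  then obtain t where "t \<in> closed_segment a r" "N (f t - f r) = y" by auto
  moreover have "0 < y" "y < \<eta>" using pos assms by (auto simp: y_def)
  ultimately show thesis using that by simp
qed

text \<open>On both sides of a local maximum, the intermediate value theorem yields points at the same level of
  \<open>\<psi>\<close>. The chord between them is parallel to the kernel. It is not zero, since a curve with increasing
  chords that returns to a point has stayed there in the meantime.\<close>
lemma level_chord:
  fixes \<psi> :: "real^2 \<Rightarrow> real"
  assumes lin: "linear \<psi>" and u: "\<psi> u \<noteq> 0" and w: "w \<noteq> 0" "\<psi> w = 0"
    and ar: "0 \<le> a" "a \<le> r" "r \<le> b" "b \<le> 1" and ne: "f a \<noteq> f r" "f b \<noteq> f r"
    and max: "\<And>t. a \<le> t \<Longrightarrow> t \<le> b \<Longrightarrow> \<psi> (f t) \<le> \<psi> (f r)"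
    and \<eta>: "0 < \<eta>"
  obtains t t' c where "0 \<le> t" "t \<le> r" "r \<le> t'" "t' \<le> 1" "f t' - f t = c *\<^sub>R w" "c \<noteq> 0"
    "N (f t - f r) < \<eta>" "N (f t' - f r) < \<eta>"
proof -
  note result = that
  have I: "a \<in> {0..1}" "b \<in> {0..1}" "r \<in> {0..1}" using ar by auto
  obtain t0 where "t0 \<in> closed_segment a r" and t0': "0 < N (f t0 - f r)" "N (f t0 - f r) < \<eta>"
    using near_point[OF I(1,3) ne(1) \<eta>] .
  then have t0: "a \<le> t0" "t0 \<le> r" using ar by (auto simp: closed_segment_eq_real_ivl)
  obtain t1 where "t1 \<in> closed_segment b r" and t1': "0 < N (f t1 - f r)" "N (f t1 - f r) < \<eta>"
    using near_point[OF I(2,3) ne(2) \<eta>] .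
  then have t1: "r \<le> t1" "t1 \<le> b" using ar by (auto simp: closed_segment_eq_real_ivl split: if_splits)
  have cont\<psi>: "continuous_on S (\<lambda>t. \<psi> (f t))" if "S \<subseteq> {0..1}" for S
    using linear_continuous_on_compose[OF continuous_on_subset[OF cont that] lin] .
  have fin: thesis if tt: "0 \<le> t" "t \<le> r" "r \<le> t'" "t' \<le> 1" and eq: "\<psi> (f t) = \<psi> (f t')"
    and ne: "f t \<noteq> f t'" and small: "N (f t - f r) < \<eta>" "N (f t' - f r) < \<eta>" for t t'
  proof -
    have "\<psi> (f t' - f t) = 0" using eq by (simp add: linear_diff[OF lin])
    then obtain c where c: "f t' - f t = c *\<^sub>R w"
      using linear_kernel_line[OF lin u w] by blast
    moreover have "c \<noteq> 0" using c ne by auto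
    ultimately show thesis using result[of t t' c] tt small by blast
  qed
  show thesis
  proof (cases "\<psi> (f t0) \<le> \<psi> (f t1)")
    case True
    have "\<psi> (f t1) \<le> \<psi> (f r)" "continuous_on {t0..r} (\<lambda>t. \<psi> (f t))"
      using max[of t1] t0 t1 ar by (auto intro: cont\<psi>)
    then obtain t where t: "t0 \<le> t" "t \<le> r" "\<psi> (f t) = \<psi> (f t1)"
      using IVT'[of "\<lambda>t. \<psi> (f t)" t0 "\<psi> (f t1)" r] True t0(2) by blast
    have "f t \<noteq> f t1"
      using constant_between[of t r t1] t t0 t1 t1' ar by auto
    moreover have "N (f r - f t) \<le> N (f r - f t0)"
      using t t0 t1 ar by (intro chord) auto
    ultimately show thesis
      using fin[of t t1] t t0 t1 t0' t1' ar by (simp add: N_minus_commute)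
  next
    case False
    have "\<psi> (f t0) \<le> \<psi> (f r)" "continuous_on {r..t1} (\<lambda>t. \<psi> (f t))"
      using max[of t0] t0 t1 ar by (auto intro: cont\<psi>)
    moreover have "\<psi> (f t1) \<le> \<psi> (f t0)" using False by simp
    ultimately obtain t where t: "r \<le> t" "t \<le> t1" "\<psi> (f t) = \<psi> (f t0)"
      using IVT2'[of "\<lambda>t. \<psi> (f t)" t1 "\<psi> (f t0)" r] t1(1) by blast
    have "f t0 \<noteq> f t"
      using constant_between[of t0 r t] t t0 t1 t0' ar by auto
    moreover have "N (f t - f r) \<le> N (f t1 - f r)"
      using t t0 t1 ar by (intro chord) auto
    ultimately show thesis
      using fin[of t0 t] t t0 t1 t0' t1' ar by simp
  qed
qed

text \<open>Growth at the approximating vector \<open>y\<close> is growth at \<open>x\<close> up to twice the distance.\<close>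
lemma N_limit_step:
  assumes y: "N y \<le> N (y + c *\<^sub>R w)" "0 < c" "c \<le> k" and close: "N (y - x) \<le> \<eta>"
  shows "N x \<le> N (x + k *\<^sub>R w) + 2 * \<eta>"
proof -
  have "N y \<le> N (y + k *\<^sub>R w)" using N_ray_mono[OF y] .
  moreover have "N x \<le> N y + \<eta>"
    using N_triangle_diff[of x y] close by (simp add: N_minus_commute)
  moreover have "N (y + k *\<^sub>R w) \<le> N (x + k *\<^sub>R w) + \<eta>"
    using N_triangle_diff[of "y + k *\<^sub>R w" "x + k *\<^sub>R w"] close by simp
  ultimately show ?thesis by simp
qed

text \<open>A weak form of: at time \<open>r\<close> the curve moves in direction \<open>w\<close>. For a differentiable curve with
  increasing chords and \<open>w = f' r\<close> this is the increasing chord property in the limit where one end of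
  both chords coincides and the other ends approach \<open>f r\<close>.\<close>
definition passes :: "real^2 \<Rightarrow> real \<Rightarrow> bool" where
  "passes w r \<longleftrightarrow> (\<forall>s\<in>{0..r}. grows w (f r - f s)) \<and> (\<forall>s\<in>{r..1}. grows w (f s - f r))"

text \<open>Arbitrarily short chords across \<open>r\<close> are multiples of \<open>w\<close>, and one of the two signs occurs for
  arbitrarily short ones. Extending a long chord that ends before \<open>r\<close> by such a short chord does not
  shorten it; in the limit the norm does not decrease in this direction.\<close>
lemma local_max_passes:
  fixes \<psi> :: "real^2 \<Rightarrow> real"
  assumes lin: "linear \<psi>" and u: "\<psi> u \<noteq> 0" and w: "w \<noteq> 0" "\<psi> w = 0"
    and ar: "0 \<le> a" "a \<le> r" "r \<le> b" "b \<le> 1" and ne: "f a \<noteq> f r" "f b \<noteq> f r"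
    and max: "\<And>t. a \<le> t \<Longrightarrow> t \<le> b \<Longrightarrow> \<psi> (f t) \<le> \<psi> (f r)"
  shows "passes w r \<or> passes (- w) r"
proof -
  let ?P = "\<lambda>\<sigma> \<eta>. \<exists>t t' c. 0 \<le> t \<and> t \<le> r \<and> r \<le> t' \<and> t' \<le> 1 \<and> f t' - f t = c *\<^sub>R \<sigma> *\<^sub>R w \<and> 0 < c \<and>
    N (f t - f r) < \<eta> \<and> N (f t' - f r) < \<eta>"
  have P_mono: "?P \<sigma> \<eta> \<Longrightarrow> \<eta> \<le> \<eta>' \<Longrightarrow> ?P \<sigma> \<eta>'" for \<sigma> \<eta> \<eta>' :: real
    by (blast intro: less_le_trans)
  have either: "?P 1 \<eta> \<or> ?P (-1) \<eta>" if \<eta>: "0 < \<eta>" for \<eta>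
  proof -
    obtain t t' c where *: "0 \<le> t" "t \<le> r" "r \<le> t'" "t' \<le> 1" "f t' - f t = c *\<^sub>R w" "c \<noteq> 0"
      "N (f t - f r) < \<eta>" "N (f t' - f r) < \<eta>"
      using level_chord[OF lin u w ar ne max \<eta>] by blast
    show ?thesis
    proof (cases "0 < c")
      case True
      then have "?P 1 \<eta>" using * by (intro exI[of _ t] exI[of _ t'] exI[of _ c]) auto
      then show ?thesis ..
    next
      case False
      then have "?P (-1) \<eta>" using * by (intro exI[of _ t] exI[of _ t'] exI[of _ "- c"]) auto
      then show ?thesis ..
    qed
  qed
  have "(\<forall>\<eta>>0. ?P 1 \<eta>) \<or> (\<forall>\<eta>>0. ?P (-1) \<eta>)"
  proof (rule ccontr)
    assume "\<not> ?thesis"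
    then obtain \<eta> \<eta>' where *: "0 < \<eta>" "\<not> ?P 1 \<eta>" "0 < \<eta>'" "\<not> ?P (-1) \<eta>'" by blast
    have "0 < min \<eta> \<eta>'" using * by simp
    from either[OF this] show False
      using P_mono[of 1 "min \<eta> \<eta>'" \<eta>] P_mono[of "-1" "min \<eta> \<eta>'" \<eta>'] * by auto
  qed
  then obtain \<sigma> :: real where \<sigma>: "\<sigma> = 1 \<or> \<sigma> = -1" and P: "\<And>\<eta>. 0 < \<eta> \<Longrightarrow> ?P \<sigma> \<eta>" by blast
  let ?w = "\<sigma> *\<^sub>R w"
  have Nw: "0 < N ?w" using w \<sigma> by (intro N_pos) auto
  have ends: "0 \<le> r" "r \<le> 1" using ar by auto
  have "passes ?w r"
    unfolding passes_def grows_def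
  proof (intro conjI ballI allI impI)
    fix s k :: real assume s: "s \<in> {0..r}" and k: "0 \<le> k"
    let ?x = "f r - f s"
    show "N ?x \<le> N (?x + k *\<^sub>R ?w)"
    proof (cases "?x = 0 \<or> k = 0")
      case False
      then have pos: "0 < N ?x" "0 < k" using k by (auto intro: N_pos)
      show ?thesis
      proof (rule field_le_epsilon)
        fix d :: real assume d: "0 < d"
        define \<eta> where "\<eta> = min (N ?x) (min (d/2) (k * N ?w / 2))"
        have \<eta>: "0 < \<eta>" "\<eta> \<le> N ?x" "2 * \<eta> \<le> d" "2 * \<eta> \<le> k * N ?w"
          using pos d Nw by (auto simp: \<eta>_def)
        obtain t t' c where *: "0 \<le> t" "t \<le> r" "r \<le> t'" "t' \<le> 1" "f t' - f t = c *\<^sub>R ?w" "0 < c"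
          "N (f t - f r) < \<eta>" "N (f t' - f r) < \<eta>"
          using P[OF \<eta>(1)] by blast
        have "s \<le> t"
        proof (rule ccontr)
          assume "\<not> s \<le> t"
          then have "N (f r - f s) \<le> N (f r - f t)"
            using * s ends by (intro chord) auto
          then show False using * \<eta> by (simp add: N_minus_commute)
        qed
        then have "N (f t - f s) \<le> N (f t' - f s)"
          using * s by (intro chord) auto
        also have "f t' - f s = f t - f s + c *\<^sub>R ?w" by (simp only: *(5)[symmetric]) simp
        finally have grow: "N (f t - f s) \<le> N (f t - f s + c *\<^sub>R ?w)" .
        have "c * N ?w = N (f t' - f t)" using * by (simp add: N_scale del: scaleR_scaleR)
        also have "\<dots> \<le> N (f t' - f r) + N (f r - f t)"
          using N_triangle[of "f t' - f r" "f r - f t"] by simp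
        also have "\<dots> \<le> k * N ?w" using * \<eta> by (simp add: N_minus_commute)
        finally have "c \<le> k" using Nw by simp
        from N_limit_step[OF grow *(6) this, of ?x \<eta>]
        show "N ?x \<le> N (?x + k *\<^sub>R ?w) + d" using * \<eta> by simp
      qed
    qed auto
  next
    fix s k :: real assume s: "s \<in> {r..1}" and k: "0 \<le> k"
    let ?x = "f s - f r"
    show "N ?x \<le> N (?x + k *\<^sub>R ?w)"
    proof (cases "?x = 0 \<or> k = 0")
      case False
      then have pos: "0 < N ?x" "0 < k" using k by (auto intro: N_pos)
      show ?thesis
      proof (rule field_le_epsilon)
        fix d :: real assume d: "0 < d"
        define \<eta> where "\<eta> = min (N ?x) (min (d/2) (k * N ?w / 2))"
        have \<eta>: "0 < \<eta>" "\<eta> \<le> N ?x" "2 * \<eta> \<le> d" "2 * \<eta> \<le> k * N ?w"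
          using pos d Nw by (auto simp: \<eta>_def)
        obtain t t' c where *: "0 \<le> t" "t \<le> r" "r \<le> t'" "t' \<le> 1" "f t' - f t = c *\<^sub>R ?w" "0 < c"
          "N (f t - f r) < \<eta>" "N (f t' - f r) < \<eta>"
          using P[OF \<eta>(1)] by blast
        have "t' \<le> s"
        proof (rule ccontr)
          assume "\<not> t' \<le> s"
          then have "N (f s - f r) \<le> N (f t' - f r)"
            using * s ends by (intro chord) auto
          then show False using * \<eta> by simp
        qed
        then have "N (f s - f t') \<le> N (f s - f t)"
          using * s by (intro chord) auto
        also have "f s - f t = f s - f t' + c *\<^sub>R ?w" by (simp only: *(5)[symmetric]) simp
        finally have grow: "N (f s - f t') \<le> N (f s - f t' + c *\<^sub>R ?w)" .
        have "c * N ?w = N (f t' - f t)" using * by (simp add: N_scale del: scaleR_scaleR)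
        also have "\<dots> \<le> N (f t' - f r) + N (f r - f t)"
          using N_triangle[of "f t' - f r" "f r - f t"] by simp
        also have "\<dots> \<le> k * N ?w" using * \<eta> by (simp add: N_minus_commute)
        finally have "c \<le> k" using Nw by simp
        from N_limit_step[OF grow *(6) this, of ?x \<eta>]
        show "N ?x \<le> N (?x + k *\<^sub>R ?w) + d" using * \<eta> by (simp add: N_minus_commute)
      qed
    qed auto
  qed
  then show ?thesis using \<sigma> by auto
qed

lemma local_min_passes:
  fixes \<psi> :: "real^2 \<Rightarrow> real"
  assumes lin: "linear \<psi>" and u: "\<psi> u \<noteq> 0" and w: "w \<noteq> 0" "\<psi> w = 0"
    and ar: "0 \<le> a" "a \<le> r" "r \<le> b" "b \<le> 1" and ne: "f a \<noteq> f r" "f b \<noteq> f r"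
    and min: "\<And>t. a \<le> t \<Longrightarrow> t \<le> b \<Longrightarrow> \<psi> (f r) \<le> \<psi> (f t)"
  shows "passes w r \<or> passes (- w) r"
  by (rule local_max_passes[of "\<lambda>x. - \<psi> x" u, OF _ _ w(1) _ ar ne])
     (use u w min in \<open>auto intro: linear_compose_neg lin\<close>)

text \<open>The end points are included because a boundary maximum of \<open>\<psi> \<circ> f\<close> carries no information about the
  direction of \<open>f\<close>. The conditions are on \<open>f r\<close> and not on \<open>r\<close>, as \<open>f\<close> may rest at an end point.\<close>
definition turning :: "real^2 \<Rightarrow> real \<Rightarrow> bool" where
  "turning w r \<longleftrightarrow> r \<in> {0..1} \<and> (f r = f 0 \<or> f r = f 1 \<or> passes w r \<or> passes (- w) r)"

lemma turning_minus [simp]: "turning (- w) r \<longleftrightarrow> turning w r"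
  by (auto simp: turning_def)

lemma turning_0 [simp]: "turning w 0" and turning_1 [simp]: "turning w 1"
  by (auto simp: turning_def)

text \<open>If \<open>L e > 0\<close>, every turning time inside the curve passes in direction \<open>w\<close> and not \<open>- w\<close>. If
  \<open>L e = 0\<close>, the orientation may vary from time to time, but then \<open>L\<close> takes the same value at all
  turning times.\<close>
lemma turning_diff:
  fixes L :: "real^2 \<Rightarrow> real"
  assumes lin: "linear L" and pos: "\<And>x. grows w x \<longleftrightarrow> 0 \<le> L x" and neg: "\<And>x. grows (- w) x \<longleftrightarrow> L x \<le> 0"
    and Le: "0 \<le> L e" and r: "turning w r" "turning w r'" "r \<le> r'"
  shows "0 \<le> L (f r' - f r)"
proof -
  note Ldiff = linear_diff[OF lin]
  have r01: "0 \<le> r" "r' \<le> 1" using r by (auto simp: turning_def)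
  have oriented: "passes w t \<or> L (f t) = L (f 0) \<and> L e = 0" if "passes w t \<or> passes (- w) t" "t \<in> {0..1}" for t
  proof (cases "passes w t")
    case False
    then have "passes (- w) t" using that by blast
    then have "L (f t - f 0) \<le> 0" "L (f 1 - f t) \<le> 0"
      using that(2) unfolding passes_def neg by auto
    then have "L (f t) = L (f 0) \<and> L e = 0"
      using Le unfolding e_eq Ldiff by auto
    then show ?thesis ..
  qed simp
  have *: "0 \<le> L (f r' - f r)" if "passes w r \<or> passes w r'"
    using that r r01 unfolding passes_def pos by auto
  consider "passes w r \<or> passes w r'"
    | "L e = 0" "L (f r) = L (f 0)" "L (f r') = L (f 0)"
    | "f r = f 0 \<or> f r = f 1" "f r' = f 0 \<or> f r' = f 1"
    | "L e = 0" "L (f r) = L (f 0)" "f r' = f 0 \<or> f r' = f 1"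
    | "L e = 0" "f r = f 0 \<or> f r = f 1" "L (f r') = L (f 0)"
    using r oriented[of r] oriented[of r'] unfolding turning_def by blast
  then show ?thesis
  proof cases
    case 3
    have "f r = f 0" if "f r' = f 0" using constant_between[of 0 r r'] that r r01 by auto
    moreover have "f r' = f 1" if "f r = f 1" using constant_between[of r r' 1] that r r01 by auto
    ultimately show ?thesis using 3 Le by (auto simp: e_eq Ldiff)
  qed (use * in \<open>auto simp: e_eq Ldiff\<close>)
qed

end

section \<open>Sums of chords over successive time intervals\<close>

text \<open>Infinite sequences serve for every number of intervals at once; entries beyond the last
  interval are often set to 1.\<close>
definition schedules :: "(nat \<Rightarrow> real) set" where
  "schedules = {t. mono t \<and> range t \<subseteq> {0..1}}"

lemma schedules_bounds: "t \<in> schedules \<Longrightarrow> 0 \<le> t i" "t \<in> schedules \<Longrightarrow> t i \<le> 1"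
  by (auto simp: schedules_def image_subset_iff)

lemma schedules_mono: "t \<in> schedules \<Longrightarrow> i \<le> j \<Longrightarrow> t i \<le> t j"
  by (auto simp: schedules_def mono_def)

lemma schedulesI: "(\<And>i. t i \<le> t (Suc i)) \<Longrightarrow> (\<And>i. 0 \<le> t i) \<Longrightarrow> (\<And>i. t i \<le> 1) \<Longrightarrow> t \<in> schedules"
  unfolding schedules_def by (auto intro: monoI lift_Suc_mono_le)

lemma compact_schedules: "compact schedules"
proof -
  have "compactin (product_topology (\<lambda>i::nat. euclidean) UNIV) (Pi\<^sub>E UNIV (\<lambda>i. {0..1::real}))"
    by (simp add: compactin_PiE)
  then have box: "compact (Pi\<^sub>E UNIV (\<lambda>i::nat. {0..1::real}))"
    by (simp only: euclidean_product_topology compactin_euclidean_iff)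
  have "closed (\<Inter>i. {t :: nat \<Rightarrow> real. t i \<le> t (Suc i)})"
    by (intro closed_INT ballI closed_Collect_le continuous_on_product_coordinates)
  then have "compact (Pi\<^sub>E UNIV (\<lambda>i::nat. {0..1}) \<inter> (\<Inter>i. {t :: nat \<Rightarrow> real. t i \<le> t (Suc i)}))"
    by (rule compact_Int_closed[OF box])
  also have "Pi\<^sub>E UNIV (\<lambda>i::nat. {0..1}) \<inter> (\<Inter>i. {t. t i \<le> t (Suc i)}) = schedules"
    by (auto simp: schedules_bounds schedules_mono PiE_iff intro: schedulesI)
  finally show ?thesis .
qed

lemma sum_lessThan_add:
  fixes g :: "nat \<Rightarrow> 'b::comm_monoid_add"
  shows "(\<Sum>k<i + r. g k) = (\<Sum>k<i. g k) + (\<Sum>k<r. g (i + k))"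
  by (induction r) (simp_all add: ac_simps)

text \<open>The name is for the use with a functional that increases on each of the \<open>n\<close> intervals
  from \<open>t (2 * j)\<close> to \<open>t (2 * j + 1)\<close>.\<close>
definition rises :: "(real \<Rightarrow> 'a::real_vector) \<Rightarrow> nat \<Rightarrow> (nat \<Rightarrow> real) \<Rightarrow> 'a" where
  "rises f n t = (\<Sum>j<n. f (t (2 * j + 1)) - f (t (2 * j)))"

text \<open>Intervals and gaps play the same role in the alternating sum. So one step (\<open>rises_drop_pair\<close>)
  covers both the removal of an interval and the merging of two intervals across a gap.\<close>
lemma rises_alternating: "rises f n t = (\<Sum>k<2 * n. (- 1) ^ Suc k *\<^sub>R f (t k))"
  by (induction n) (simp_all add: rises_def)

lemma rises_telescope:
  "f (t (2 * n)) - f (t 0) = rises f n t + (\<Sum>j<n. f (t (2 * j + 2)) - f (t (2 * j + 1)))"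
  by (induction n) (simp_all add: rises_def algebra_simps)

lemma rises_update:
  assumes "i < 2 * n"
  shows "rises f n (t(i := s)) = rises f n t + (- 1) ^ Suc i *\<^sub>R (f s - f (t i))"
proof -
  let ?g = "\<lambda>t k. (- 1) ^ Suc k *\<^sub>R f (t k)"
  have "(\<Sum>k<2 * n. ?g (t(i := s)) k) = ?g (t(i := s)) i + (\<Sum>k\<in>{..<2*n} - {i}. ?g (t(i := s)) k)"
    using assms by (intro sum.remove) auto
  also have "(\<Sum>k\<in>{..<2*n} - {i}. ?g (t(i := s)) k) = (\<Sum>k\<in>{..<2*n} - {i}. ?g t k)"
    by (intro sum.cong) auto
  also have "\<dots> = (\<Sum>k<2 * n. ?g t k) - ?g t i"
    using sum.remove[of "{..<2*n}" i "?g t"] assms by simp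
  finally show ?thesis unfolding rises_alternating by (simp add: algebra_simps)
qed

lemma rises_drop_pair:
  assumes "Suc i < 2 * Suc n" and eq: "f (t i) = f (t (Suc i))"
  shows "rises f (Suc n) t = rises f n (\<lambda>k. if k < i then t k else t (k + 2))"
proof -
  let ?g = "\<lambda>k. (- 1) ^ Suc k *\<^sub>R f (t k)"
  let ?t = "\<lambda>k. if k < i then t k else t (k + 2)"
  define r where "r = 2 * n - i"
  have r: "2 * Suc n = i + (2 + r)" "2 * n = i + r"
    using assms(1) by (auto simp: r_def)
  have pair: "(\<Sum>k<2. ?g (i + k)) = 0" using eq by (simp add: numeral_2_eq_2)
  have "(\<Sum>k<2 * Suc n. ?g k) = (\<Sum>k<i. ?g k) + (\<Sum>k<r. ?g (i + (2 + k)))"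
    by (simp only: r(1) sum_lessThan_add pair add_0_left)
  also have "\<dots> = (\<Sum>k<2 * n. (- 1) ^ Suc k *\<^sub>R f (?t k))"
    unfolding r(2) by (simp add: sum_lessThan_add[of _ i] add.commute[of 2])
  finally show ?thesis unfolding rises_alternating .
qed

lemma rises_pad: "m \<le> n \<Longrightarrow> rises f n (\<lambda>k. if k < 2 * m then t k else 1) = rises f m t"
  by (induction n rule: dec_induct) (simp_all add: rises_def)

lemma pad_schedules: "t \<in> schedules \<Longrightarrow> (\<lambda>k. if k < m then t k else 1) \<in> schedules"
  by (rule schedulesI) (auto simp: schedules_bounds schedules_mono)

context unit_increasing_chord_curve
begin

definition rise_set :: "nat \<Rightarrow> (real^2) set" where
  "rise_set n = rises f n ` schedules"

lemma rise_set_mono: "m \<le> n \<Longrightarrow> rise_set m \<subseteq> rise_set n"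
  unfolding rise_set_def
proof (intro image_subsetI)
  fix t assume "m \<le> n" "t \<in> schedules"
  then show "rises f m t \<in> rises f n ` schedules"
    by (intro image_eqI[where x = "\<lambda>k. if k < 2 * m then t k else 1"])
      (simp_all add: rises_pad pad_schedules)
qed

lemma compact_rise_set: "compact (rise_set n)"
proof -
  have "continuous_on schedules (\<lambda>t. f (t i))" for i
    by (rule continuous_on_compose2[OF cont continuous_on_subset[OF continuous_on_product_coordinates]])
       (auto simp: schedules_bounds)
  then have "continuous_on schedules (rises f n)"
    unfolding rises_def by (intro continuous_on_sum continuous_on_diff)
  then show ?thesis unfolding rise_set_def by (rule compact_continuous_image[OF _ compact_schedules])
qed

lemma rise_set_nonempty: "rise_set n \<noteq> {}"
proof -
  have "(\<lambda>_. 0) \<in> schedules" by (rule schedulesI) auto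
  then show ?thesis by (auto simp: rise_set_def)
qed

lemma rise_set_attains_sup:
  assumes "continuous_on UNIV (F :: real^2 \<Rightarrow> real)"
  obtains x where "x \<in> rise_set n" "\<And>y. y \<in> rise_set n \<Longrightarrow> F y \<le> F x"
  using continuous_attains_sup[OF compact_rise_set rise_set_nonempty continuous_on_subset[OF assms subset_UNIV]]
  by blast

lemma e_minus_rise: "x \<in> rise_set n \<Longrightarrow> e - x \<in> rise_set (Suc n)"
proof -
  assume "x \<in> rise_set n"
  then obtain t where t: "t \<in> schedules" and x: "x = rises f n (\<lambda>k. if k < 2 * n then t k else 1)"
    unfolding rise_set_def using rises_pad[of n n f] by auto
  define s where "s k = (if k < 2 * n then t k else 1)" for k
  have s: "s \<in> schedules" unfolding s_def by (rule pad_schedules[OF t])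
  define s' where "s' k = (case k of 0 \<Rightarrow> 0 | Suc j \<Rightarrow> s j)" for k
  have xs: "x = rises f n s" unfolding x by (rule arg_cong[of _ _ "rises f n"]) (simp add: s_def fun_eq_iff)
  have "f (s (2 * n)) = f 1" by (simp add: s_def)
  then have "f 1 - f (s 0) = x + (\<Sum>j<n. f (s (2 * j + 2)) - f (s (2 * j + 1)))"
    using rises_telescope[of f s n] xs by simp
  then have "e - x = f (s 0) - f 0 + (\<Sum>j<n. f (s (2 * j + 2)) - f (s (2 * j + 1)))"
    by (simp add: e_eq algebra_simps)
  moreover have "s' \<in> schedules"
    by (rule schedulesI) (auto simp: s'_def schedules_bounds[OF s] schedules_mono[OF s] split: nat.split)
  moreover have "rises f (Suc n) s' = f (s 0) - f 0 + (\<Sum>j<n. f (s (2 * j + 2)) - f (s (2 * j + 1)))"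
    unfolding rises_def sum.lessThan_Suc_shift by (simp add: s'_def)
  ultimately have "e - x = rises f (Suc n) s'" "s' \<in> schedules" by simp_all
  then show ?thesis unfolding rise_set_def by (rule image_eqI)
qed

text \<open>Represent \<open>x\<close> with the least number of intervals. Then \<open>f\<close> takes different values at successive
  times of the representation, by \<open>rises_drop_pair\<close>. Moving one of these times between its neighbours
  changes the sum by a chord, so maximality makes each time an extremum of \<open>\<psi> \<circ> f\<close> between its
  neighbours.\<close>
lemma maximal_rise_turning:
  fixes \<psi> :: "real^2 \<Rightarrow> real"
  assumes lin: "linear \<psi>" and u: "\<psi> u \<noteq> 0" and w: "w \<noteq> 0" "\<psi> w = 0"
    and x: "x \<in> rise_set n" and max: "\<And>y. y \<in> rise_set n \<Longrightarrow> \<psi> y \<le> \<psi> x"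
  obtains m t where "m \<le> n" "t \<in> schedules" "\<And>k. 2 * m \<le> k \<Longrightarrow> t k = 1" "x = rises f m t"
    "\<And>i. turning w (t i)"
proof -
  define m where "m = (LEAST m. x \<in> rise_set m)"
  have xm: "x \<in> rise_set m" unfolding m_def using x by (rule LeastI)
  have least: "m \<le> k" if "x \<in> rise_set k" for k
    unfolding m_def using that by (rule Least_le)
  have mn: "m \<le> n" using x by (rule least)
  obtain t0 where t0: "t0 \<in> schedules" "x = rises f m t0" using xm by (auto simp: rise_set_def)
  define t where "t k = (if k < 2 * m then t0 k else 1)" for k
  have t: "t \<in> schedules" unfolding t_def by (rule pad_schedules[OF t0(1)])
  have xt: "x = rises f m t" unfolding t_def using rises_pad[of m m f t0] t0 by simp
  have distinct: "f (t i) \<noteq> f (t (Suc i))" if i: "Suc i < 2 * m" for i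
  proof
    assume eq: "f (t i) = f (t (Suc i))"
    obtain m' where m': "m = Suc m'" using i by (cases m) auto
    let ?t = "\<lambda>k. if k < i then t k else t (k + 2)"
    have "?t \<in> schedules" by (rule schedulesI) (auto simp: schedules_bounds[OF t] schedules_mono[OF t])
    moreover have "x = rises f m' ?t"
      using rises_drop_pair[of i m' f t] i eq xt m' by simp
    ultimately have "x \<in> rise_set m'" by (auto simp: rise_set_def)
    then show False using least[of m'] m' by simp
  qed
  have turn: "turning w (t i)" for i
  proof (cases "i < 2 * m")
    case True
    define a where "a = (case i of 0 \<Rightarrow> 0 | Suc j \<Rightarrow> t j)"
    let ?b = "t (Suc i)"
    have ab: "0 \<le> a" "a \<le> t i" "t i \<le> ?b" "?b \<le> 1"
      by (auto simp: a_def schedules_bounds[OF t] schedules_mono[OF t] split: nat.split)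
    have opt: "(- 1) ^ Suc i * (\<psi> (f s) - \<psi> (f (t i))) \<le> 0" if s: "a \<le> s" "s \<le> ?b" for s
    proof -
      have s01: "0 \<le> s" "s \<le> 1" using s ab by linarith+
      have "t(i := s) \<in> schedules"
      proof (rule schedulesI)
        fix j
        consider "j = i" | "Suc j = i" | "j \<noteq> i" "Suc j \<noteq> i" by blast
        then show "(t(i := s)) j \<le> (t(i := s)) (Suc j)"
        proof cases
          case 2
          then have "a = t j" by (auto simp: a_def)
          then show ?thesis using 2 s by auto
        qed (use s in \<open>auto simp: schedules_mono[OF t]\<close>)
        show "0 \<le> (t(i := s)) j" "(t(i := s)) j \<le> 1"
          using s ab s01 by (auto simp: schedules_bounds[OF t])
      qed
      then have "rises f m (t(i := s)) \<in> rise_set n"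
        using rise_set_mono[OF mn] by (auto simp: rise_set_def)
      then have "\<psi> (x + (- 1) ^ Suc i *\<^sub>R (f s - f (t i))) \<le> \<psi> x"
        using max rises_update[OF True, of f t s] xt by metis
      then show ?thesis
        by (simp add: linear_add[OF lin] linear_scale[OF lin] linear_diff[OF lin] del: power_Suc)
    qed
    have t01: "t i \<in> {0..1}" by (auto simp: schedules_bounds[OF t])
    show ?thesis
    proof (cases "f a = f (t i) \<or> f ?b = f (t i)")
      case True
      then have "f (t i) = f 0 \<or> f (t i) = f 1"
      proof
        assume "f a = f (t i)"
        then have "i = 0" using distinct[of "i - 1"] \<open>i < 2 * m\<close> by (cases i) (auto simp: a_def)
        then show ?thesis using \<open>f a = f (t i)\<close> by (simp add: a_def)
      next
        assume eq: "f ?b = f (t i)"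
        then have "\<not> Suc i < 2 * m" using distinct[of i] by auto
        then have "?b = 1" by (simp add: t_def)
        then show ?thesis using eq by simp
      qed
      then show ?thesis using t01 by (auto simp: turning_def)
    next
      case False
      then have ne: "f a \<noteq> f (t i)" "f ?b \<noteq> f (t i)" by auto
      have "passes w (t i) \<or> passes (- w) (t i)"
      proof (cases "even i")
        case True
        then show ?thesis
          using opt by (intro local_min_passes[OF lin u w ab ne]) auto
      next
        case False
        then show ?thesis
          using opt by (intro local_max_passes[OF lin u w ab ne]) auto
      qed
      then show ?thesis using t01 by (auto simp: turning_def)
    qed
  qed (simp add: t_def)
  show thesis using that[OF mn t _ xt turn] by (simp add: t_def)
qed

text \<open>Both \<open>x\<close> and \<open>e - x\<close> are sums of chords between turning times, and vectors from which the norm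
  grows in a fixed direction form a half plane.\<close>
lemma maximal_rise_grows:
  fixes \<psi> :: "real^2 \<Rightarrow> real"
  assumes lin: "linear \<psi>" and u: "\<psi> u \<noteq> 0" and w: "w \<noteq> 0" "\<psi> w = 0"
    and x: "x \<in> rise_set n" and max: "\<And>y. y \<in> rise_set n \<Longrightarrow> \<psi> y \<le> \<psi> x"
  shows "grows w x \<and> grows w (e - x) \<or> grows (- w) x \<and> grows (- w) (e - x)"
proof -
  obtain m t where t: "t \<in> schedules" and t1: "\<And>k. 2 * m \<le> k \<Longrightarrow> t k = 1" and xt: "x = rises f m t"
    and turn: "\<And>i. turning w (t i)"
    using maximal_rise_turning[OF lin u w x max] by blast
  obtain L :: "real^2 \<Rightarrow> real" where L: "linear L" "0 < L w"
    and pos: "\<And>x. grows w x \<longleftrightarrow> 0 \<le> L x" and neg: "\<And>x. grows (- w) x \<longleftrightarrow> L x \<le> 0"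
    using grows_half_plane[OF w(1)] by blast
  have "f (t (2 * m)) = f 1" using t1[of "2 * m"] by simp
  then have ex: "e - x = (f (t 0) - f 0) + (\<Sum>j<m. f (t (2 * j + 2)) - f (t (2 * j + 1)))"
    using rises_telescope[of f t m] xt by (simp add: e_eq algebra_simps)
  \<comment> \<open>Replacing \<open>w\<close> by \<open>- w\<close> if necessary, \<open>e\<close> lies in the half plane.\<close>
  have key: "0 \<le> K x \<and> 0 \<le> K (e - x)"
    if K: "linear K" "\<And>x. grows v x \<longleftrightarrow> 0 \<le> K x" "\<And>x. grows (- v) x \<longleftrightarrow> K x \<le> 0" "0 \<le> K e"
      and v: "\<And>r. turning v r \<longleftrightarrow> turning w r" for K :: "real^2 \<Rightarrow> real" and v
  proof -
    have d: "0 \<le> K (f (t j) - f (t i))" if "i \<le> j" for i j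
      using that turn by (intro turning_diff[OF K]) (auto simp: v schedules_mono[OF t])
    have d0: "0 \<le> K (f (t 0) - f 0)"
      using turn[of 0] by (intro turning_diff[OF K]) (auto simp: v schedules_bounds[OF t])
    have "0 \<le> K x" unfolding xt rises_def linear_sum[OF K(1)] by (intro sum_nonneg d) simp
    moreover have "0 \<le> K (e - x)"
      unfolding ex linear_add[OF K(1)] linear_sum[OF K(1)] by (intro add_nonneg_nonneg sum_nonneg d d0) simp
    ultimately show ?thesis ..
  qed
  show ?thesis
  proof (cases "0 \<le> L e")
    case True
    then show ?thesis using key[of L w] L pos neg by simp
  next
    case False
    have "linear (\<lambda>x. - L x)" using L(1) by (rule linear_compose_neg)
    then show ?thesis using key[of "\<lambda>x. - L x" "- w"] False pos neg by simp
  qed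
qed

text \<open>Here the extrema of the functional lie on the line through \<open>f 0\<close> and \<open>f 1\<close>, because \<open>e\<close> is then on the
  boundary of the half plane of the kernel direction. On this line the increasing chord property forces
  the order of time. So the largest decrease of \<open>\<phi> \<circ> f\<close>, which is attained between two extrema, is zero.\<close>
lemma norming_increasing:
  fixes \<phi> :: "real^2 \<Rightarrow> real"
  assumes lin: "linear \<phi>" and \<phi>e: "\<phi> e = 1" and le: "\<And>z. \<phi> z \<le> N z"
    and sr: "0 \<le> s" "s \<le> r" "r \<le> 1"
  shows "\<phi> (f s) \<le> \<phi> (f r)"
proof -
  define \<psi> where "\<psi> z = - \<phi> z" for z
  have lin\<psi>: "linear \<psi>" unfolding \<psi>_def by (rule linear_compose_neg[OF lin])
  have e0: "e \<noteq> 0" using Ne by auto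
  obtain y where y: "0 < cross2 e y" using cross2_rotate_pos[OF e0] .
  define w where "w = y - \<phi> y *\<^sub>R e"
  have \<phi>w: "\<phi> w = 0" by (simp add: w_def linear_diff[OF lin] linear_scale[OF lin] \<phi>e)
  have w0: "w \<noteq> 0"
  proof
    assume "w = 0"
    then have "y = \<phi> y *\<^sub>R e" by (simp add: w_def)
    then have "cross2 e y = cross2 e (\<phi> y *\<^sub>R e)" by simp
    then have "cross2 e y = 0" by (simp add: linear_scale[OF linear_cross2_right])
    then show False using y by simp
  qed
  obtain L :: "real^2 \<Rightarrow> real" where L: "linear L" "0 < L w"
    and pos: "\<And>x. grows w x \<longleftrightarrow> 0 \<le> L x" and neg: "\<And>x. grows (- w) x \<longleftrightarrow> L x \<le> 0"
    using grows_half_plane[OF w0] by blast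
  have "N e \<le> N (e + s *\<^sub>R w)" for s
    using le[of "e + s *\<^sub>R w"] by (simp add: linear_add[OF lin] linear_scale[OF lin] \<phi>e \<phi>w Ne)
  from this[of "- _"] this have "grows w e" "grows (- w) e" by (auto simp: grows_def)
  then have Le: "L e = 0" using pos neg by (auto intro: antisym)
  have on_axis: "\<exists>a. f t = f 0 + a *\<^sub>R e" if "turning w t" for t
  proof -
    have t01: "0 \<le> t" "t \<le> 1" using that by (auto simp: turning_def)
    have "0 \<le> L (f t - f 0)" "0 \<le> L (f 1 - f t)"
      using that t01 Le by (auto intro!: turning_diff[OF L(1) pos neg])
    then have "L (f t - f 0) = 0" using Le by (simp add: e_eq linear_diff[OF L(1)])
    then obtain a where "f t - f 0 = a *\<^sub>R e"
      using linear_kernel_line[OF L(1), of w e "f t - f 0"] L(2) e0 Le by auto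
    then have "f t = f 0 + a *\<^sub>R e" by (simp add: algebra_simps)
    then show ?thesis ..
  qed
  have "continuous_on UNIV \<psi>"
    using lin\<psi> by (simp add: linear_continuous_on linear_conv_bounded_linear)
  then obtain x where x: "x \<in> rise_set 1" and max: "\<And>y. y \<in> rise_set 1 \<Longrightarrow> \<psi> y \<le> \<psi> x"
    using rise_set_attains_sup[of \<psi> 1] by blast
  have \<psi>ew: "\<psi> e \<noteq> 0" "\<psi> w = 0" by (simp_all add: \<psi>_def \<phi>e \<phi>w)
  have "0 \<le> \<phi> x"
  proof -
    obtain m t where m: "m \<le> 1" and t: "t \<in> schedules" and xt: "x = rises f m t"
      and turn: "\<And>i. turning w (t i)"
      using maximal_rise_turning[OF lin\<psi> \<psi>ew(1) w0 \<psi>ew(2) x max] by blast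
    show ?thesis
    proof (cases m)
      case 0
      then show ?thesis using xt by (simp add: rises_def linear_0[OF lin])
    next
      case (Suc m')
      then have x1: "x = f (t 1) - f (t 0)" using m xt by (simp add: rises_def)
      obtain a b where a: "f (t 0) = f 0 + a *\<^sub>R e" and b: "f (t 1) = f 0 + b *\<^sub>R e"
        using on_axis turn by blast
      have tt: "0 \<le> t 0" "t 0 \<le> t 1" "t 1 \<le> 1" by (simp_all add: schedules_bounds[OF t] schedules_mono[OF t])
      have "N (f (t 0) - f 0) \<le> N (f (t 1) - f 0)" "N (f (t 1) - f 0) \<le> N e"
        "N (f 1 - f (t 1)) \<le> N (f 1 - f (t 0))"
        unfolding e_eq using tt by (auto intro!: chord)
      moreover have "f 1 - f (t 1) = (1 - b) *\<^sub>R e" "f 1 - f (t 0) = (1 - a) *\<^sub>R e"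
        using a b by (simp_all add: e_eq algebra_simps)
      ultimately have "\<bar>a\<bar> \<le> \<bar>b\<bar>" "\<bar>b\<bar> \<le> 1" "\<bar>1 - b\<bar> \<le> \<bar>1 - a\<bar>"
        using a b Ne by (simp_all add: N_scale)
      then have "a \<le> b" by linarith
      then show ?thesis using x1 a b by (simp add: linear_diff[OF lin] linear_add[OF lin] linear_scale[OF lin] \<phi>e)
    qed
  qed
  moreover have "f r - f s \<in> rise_set 1"
  proof -
    have "f r - f s = rises f 1 (\<lambda>k. if k = 0 then s else r)" by (simp add: rises_def)
    moreover have "(\<lambda>k. if k = 0 then s else r) \<in> schedules"
      using sr by (intro schedulesI) auto
    ultimately show ?thesis unfolding rise_set_def by (rule image_eqI)
  qed
  ultimately show ?thesis using max[of "f r - f s"] by (simp add: \<psi>_def linear_diff[OF lin])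
qed

lemma norming_rise_bounds:
  fixes \<phi> :: "real^2 \<Rightarrow> real"
  assumes lin: "linear \<phi>" and \<phi>e: "\<phi> e = 1" and le: "\<And>z. \<phi> z \<le> N z" and x: "x \<in> rise_set n"
  shows "0 \<le> \<phi> x" and "\<phi> x \<le> 1"
proof -
  have nonneg: "0 \<le> \<phi> y" if y: "y \<in> rise_set k" for y k
  proof -
    obtain t where t: "t \<in> schedules" "y = rises f k t" using y by (auto simp: rise_set_def)
    have "\<phi> (f (t (2 * j))) \<le> \<phi> (f (t (2 * j + 1)))" for j
      by (rule norming_increasing[OF lin \<phi>e le])
         (auto intro: schedules_bounds[OF t(1)] schedules_mono[OF t(1)])
    then show ?thesis
      unfolding t(2) rises_def linear_sum[OF lin] linear_diff[OF lin] by (intro sum_nonneg) simp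
  qed
  show "0 \<le> \<phi> x" by (rule nonneg[OF x])
  show "\<phi> x \<le> 1" using nonneg[OF e_minus_rise[OF x]] by (simp add: linear_diff[OF lin] \<phi>e)
qed

text \<open>The functional \<open>\<psi>\<close> in the proof is a subgradient of \<open>F\<close> at its maximiser \<open>x\<close>, and \<open>v = e - \<tau> *\<^sub>R x\<close>
  spans its kernel. The term \<open>\<epsilon> * \<phi>\<close> in \<open>F\<close> tilts the level line of \<open>F\<close> through \<open>x\<close> against that of the
  norm: in direction \<open>v\<close> the functional \<open>\<phi>\<close> increases, hence the norm decreases. With the norm alone,
  \<open>v\<close> would be tangent to a disk and \<open>maximal_rise_grows\<close> would give no contradiction.\<close>
lemma N_rise_le_1:
  assumes z: "z \<in> rise_set n"
  shows "N z \<le> 1"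
proof (rule ccontr)
  assume "\<not> ?thesis"
  then have Nz: "1 < N z" by simp
  have e0: "e \<noteq> 0" using Ne by auto
  obtain \<phi> where lin\<phi>: "linear \<phi>" and \<phi>e: "\<phi> e = 1" and \<phi>_le: "\<And>z. \<phi> z \<le> N z"
    using norming_functional[OF e0] Ne by metis
  note \<phi>_bounds = norming_rise_bounds[OF lin\<phi> \<phi>e \<phi>_le]
  define \<epsilon> where "\<epsilon> = (N z - 1) / 2"
  have \<epsilon>: "0 < \<epsilon>" "1 + \<epsilon> < N z" using Nz by (auto simp: \<epsilon>_def field_simps)
  define F where "F y = N y + \<epsilon> * \<phi> y" for y
  have cont\<phi>: "continuous_on UNIV \<phi>" using lin\<phi> by (simp add: linear_continuous_on linear_conv_bounded_linear)
  have "continuous_on UNIV F" unfolding F_def by (intro continuous_intros cont\<phi>)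
  then obtain x where x: "x \<in> rise_set n" and max: "\<And>y. y \<in> rise_set n \<Longrightarrow> F y \<le> F x"
    using rise_set_attains_sup by blast
  have Fx: "1 + \<epsilon> < F x"
    using max[OF z] \<epsilon> mult_nonneg_nonneg[of \<epsilon> "\<phi> z"] \<phi>_bounds(1)[OF z] unfolding F_def by linarith
  have \<phi>x: "0 \<le> \<phi> x" "\<phi> x \<le> 1" by (rule \<phi>_bounds[OF x])+
  have Nx: "1 < N x"
    using Fx \<phi>x \<epsilon>(1) mult_left_le[of "\<phi> x" \<epsilon>] unfolding F_def by linarith
  \<comment> \<open>A multiple of \<open>e\<close> outside the unit disk would violate the bounds on \<open>\<phi> x\<close>.\<close>
  have indep: "cross2 x e \<noteq> 0"
  proof
    assume "cross2 x e = 0"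
    moreover obtain y where y: "0 < cross2 e y" using cross2_rotate_pos[OF e0] .
    ultimately have "cross2 e y *\<^sub>R x = cross2 x y *\<^sub>R e"
      using cross2_expand[of e y x] cross2_skew[of e x] by simp
    then have "x = (cross2 x y / cross2 e y) *\<^sub>R e"
      using y by (metis divideR_right divide_inverse_commute less_irrefl scaleR_scaleR)
    then obtain c where c: "x = c *\<^sub>R e" by blast
    then show False using \<phi>x Nx by (simp add: N_scale Ne linear_scale[OF lin\<phi>] \<phi>e)
  qed
  obtain \<rho> where lin\<rho>: "linear \<rho>" and \<rho>x: "\<rho> x = N x" and \<rho>_le: "\<And>z. \<rho> z \<le> N z"
    and slope: "\<And>\<delta>. 0 < \<delta> \<Longrightarrow> \<exists>s>0. N (x + s *\<^sub>R e) < N x + s * (\<rho> e + \<delta>)"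
    using directional_norming_functional[OF indep] by blast
  define D where "D = \<rho> e"
  have D1: "D \<le> 1" using \<rho>_le[of e] Ne by (simp add: D_def)
  define \<psi> where "\<psi> y = \<rho> y + \<epsilon> * \<phi> y" for y
  have lin\<psi>: "linear \<psi>"
    unfolding \<psi>_def by (intro linearI) (simp_all add: linear_add[OF lin\<rho>] linear_add[OF lin\<phi>]
        linear_scale[OF lin\<rho>] linear_scale[OF lin\<phi>] algebra_simps)
  have \<psi>x: "\<psi> x = F x" by (simp add: \<psi>_def F_def \<rho>x)
  have \<psi>_max: "\<psi> y \<le> \<psi> x" if "y \<in> rise_set n" for y
    using \<rho>_le[of y] max[OF that] \<psi>x by (simp add: \<psi>_def F_def)
  define \<tau> where "\<tau> = (D + \<epsilon>) / F x"
  define v where "v = e - \<tau> *\<^sub>R x"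
  have \<tau>1: "\<tau> \<le> 1" using D1 Fx \<epsilon> by (simp add: \<tau>_def)
  have \<psi>v: "\<psi> v = 0"
  proof -
    have "\<psi> v = \<psi> e - \<tau> * F x"
      by (simp add: v_def linear_diff[OF lin\<psi>] linear_scale[OF lin\<psi>] \<psi>x)
    then show ?thesis using Fx \<epsilon> by (simp add: \<psi>_def D_def \<phi>e \<tau>_def)
  qed
  have v0: "v \<noteq> 0"
    using indep by (auto simp: v_def linear_scale[OF linear_cross2_right])
  have "\<psi> x \<noteq> 0" using \<psi>x Fx \<epsilon> by simp
  \<comment> \<open>Growth in direction \<open>v\<close> is used at \<open>x\<close>, growth in direction \<open>- v\<close> at \<open>e - x\<close>; both imply that the
    right derivative of the norm at \<open>x\<close> in direction \<open>v\<close>, which is \<open>D - \<tau> * N x\<close>, is nonnegative.\<close>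
  from maximal_rise_grows[OF lin\<psi> this v0 \<psi>v x \<psi>_max]
  have "\<tau> * N x \<le> D"
  proof
    assume "grows v x \<and> grows v (e - x)"
    then have g: "N x \<le> N (x + s *\<^sub>R v)" if "0 \<le> s" for s using that by (simp add: grows_def)
    show "\<tau> * N x \<le> D"
    proof (rule field_le_epsilon)
      fix \<delta> :: real assume "0 < \<delta>"
      then obtain s where s: "0 < s" "N (x + s *\<^sub>R e) < N x + s * (D + \<delta>)"
        using slope unfolding D_def by blast
      have "(1 + s * \<tau>) * N x \<le> N (x + s *\<^sub>R e)"
      proof (cases "0 \<le> \<tau>")
        case True
        define c where "c = 1 + s * \<tau>"
        have c: "0 < c" using s True by (simp add: c_def add_pos_nonneg)
        have "x + s *\<^sub>R e = c *\<^sub>R (x + (s / c) *\<^sub>R v)"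
          using c by (simp add: scaleR_add_right) (simp add: c_def v_def algebra_simps)
        then have "N (x + s *\<^sub>R e) = c * N (x + (s / c) *\<^sub>R v)"
          by (simp only: N_scale abs_of_pos[OF c])
        then show ?thesis
          using g[of "s / c"] c s mult_left_mono[of "N x" "N (x + (s / c) *\<^sub>R v)" c] by (simp add: c_def)
      next
        case False
        have "N x \<le> N (x + s *\<^sub>R v)" using g s by simp
        also have "x + s *\<^sub>R v = (x + s *\<^sub>R e) + (- s * \<tau>) *\<^sub>R x" by (simp add: v_def algebra_simps)
        also have "N \<dots> \<le> N (x + s *\<^sub>R e) + N ((- s * \<tau>) *\<^sub>R x)" by (rule N_triangle)
        also have "N ((- s * \<tau>) *\<^sub>R x) = (- s * \<tau>) * N x"
          using False s by (simp only: N_scale) (simp add: abs_mult)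
        finally show ?thesis by (simp add: algebra_simps)
      qed
      then have "s * (\<tau> * N x) < s * (D + \<delta>)" using s by (simp add: algebra_simps)
      then show "\<tau> * N x \<le> D + \<delta>" using s by simp
    qed
  next
    assume "grows (- v) x \<and> grows (- v) (e - x)"
    then have "N (e - x) \<le> N (e - x + 1 *\<^sub>R - v)" unfolding grows_def by (meson zero_le_one)
    also have "e - x + 1 *\<^sub>R - v = (\<tau> - 1) *\<^sub>R x" by (simp add: v_def algebra_simps)
    also have "N \<dots> = (1 - \<tau>) * N x" using \<tau>1 by (simp add: N_scale)
    finally have "N (e - x) \<le> (1 - \<tau>) * N x" .
    moreover have "N x - D \<le> N (e - x)"
      using \<rho>_le[of "x - e"] by (simp add: linear_diff[OF lin\<rho>] \<rho>x D_def N_minus_commute)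
    ultimately show "\<tau> * N x \<le> D" by (simp add: algebra_simps)
  qed
  then have "(D + \<epsilon>) * N x \<le> D * F x" using Fx \<epsilon> by (simp add: \<tau>_def field_simps)
  then have "\<epsilon> * N x \<le> \<epsilon> * (D * \<phi> x)" by (simp add: F_def algebra_simps)
  then have "N x \<le> D * \<phi> x" using \<epsilon> by simp
  also have "\<dots> \<le> 1" using D1 \<phi>x by (meson mult_le_one mult_right_mono order_trans mult_1)
  finally show False using Nx by simp
qed

end

section \<open>A finite Crofton formula\<close>

text \<open>The first hypothesis says that the sequence never increases again once it has decreased. So it
  climbs to one peak and then descends.\<close>
lemma unimodal_variation_le:
  fixes a :: "nat \<Rightarrow> real"
  assumes "\<And>k l. k < l \<Longrightarrow> l < n \<Longrightarrow> a (Suc k) < a k \<Longrightarrow> a (Suc l) \<le> a l"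
    and "\<And>k. k \<le> n \<Longrightarrow> a k \<le> B"
  shows "(\<Sum>k<n. \<bar>a (Suc k) - a k\<bar>) \<le> 2 * B - a 0 - a n"
  using assms
proof (induction n)
  case (Suc n)
  show ?case
  proof (cases "a (Suc n) \<le> a n")
    case True
    have "(\<Sum>k<n. \<bar>a (Suc k) - a k\<bar>) \<le> 2 * B - a 0 - a n"
      using Suc.prems by (intro Suc.IH) auto
    then show ?thesis using True by simp
  next
    case False
    then have up: "a k \<le> a (Suc k)" if "k < Suc n" for k
      using Suc.prems(1)[of k n] that by (cases "k = n") (auto simp: not_le intro: leI)
    then have "(\<Sum>k<Suc n. \<bar>a (Suc k) - a k\<bar>) = (\<Sum>k<Suc n. a (Suc k) - a k)"
      by (intro sum.cong) auto
    also have "\<dots> = a (Suc n) - a 0" by (rule sum_lessThan_telescope)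
    finally show ?thesis using Suc.prems(2)[of "Suc n"] by simp
  qed
qed simp

lemma abs_diff_le_variation:
  fixes a :: "nat \<Rightarrow> real"
  assumes "i \<le> j"
  shows "\<bar>a j - a i\<bar> \<le> (\<Sum>k=i..<j. \<bar>a (Suc k) - a k\<bar>)"
  using assms by (induction j rule: dec_induct) auto

lemma closed_variation_ge:
  fixes a :: "nat \<Rightarrow> real"
  assumes "a n = a 0" "i \<le> n" "j \<le> n"
  shows "2 * \<bar>a i - a j\<bar> \<le> (\<Sum>k<n. \<bar>a (Suc k) - a k\<bar>)"
proof -
  define V where "V i j = (\<Sum>k=i..<j. \<bar>a (Suc k) - a k\<bar>)" for i j
  have V: "\<bar>a j - a i\<bar> \<le> V i j" if "i \<le> j" for i j
    unfolding V_def by (rule abs_diff_le_variation[OF that])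
  have *: "2 * \<bar>a j - a i\<bar> \<le> V 0 n" if "i \<le> j" "j \<le> n" for i j
  proof -
    have "V 0 n = V 0 i + V i j + V j n"
      using that by (simp add: V_def sum.atLeastLessThan_concat)
    moreover have "\<bar>a i - a 0\<bar> + \<bar>a j - a i\<bar> + \<bar>a n - a j\<bar> \<le> V 0 i + V i j + V j n"
      using that by (intro add_mono V) auto
    moreover have "\<bar>a j - a i\<bar> \<le> \<bar>a i - a 0\<bar> + \<bar>a n - a j\<bar>" using assms(1) by simp
    ultimately show ?thesis by argo
  qed
  show ?thesis
    using *[of i j] *[of j i] assms
    by (cases "i \<le> j") (auto simp: V_def abs_minus_commute atLeast0LessThan)
qed

context strictly_convex_norm
begin

text \<open>Order the directions of \<open>V\<close> by slope, take a norming functional \<open>\<phi> k\<close> for each, and close the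
  list by \<open>\<phi> n = - \<phi> 0\<close>, which belongs to the negative of the first direction. Then
  \<open>\<psi> k = (\<phi> (Suc k) - \<phi> k) / 2\<close> will do. Geometrically, the \<open>\<phi> k\<close> and their negatives run around
  a symmetric polygon in the dual plane, and such a polygon is a Minkowski sum of segments, one for each
  pair of opposite edges.

  For fixed \<open>y\<close> the values \<open>\<phi> k y\<close> lie between \<open>- N y\<close> and \<open>N y\<close>, start and end at opposite values, and
  for one of \<open>y\<close> and \<open>- y\<close> they are unimodal, so their variation is at most \<open>2 * N y\<close>. If \<open>y\<close> is one of
  the directions, the value \<open>N y\<close> is attained on the way from \<open>\<phi> 0 y\<close> to \<open>- \<phi> 0 y\<close>, so the variation
  is exactly \<open>2 * N y\<close>.\<close>
theorem finite_Crofton: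
  assumes fin: "finite V"
  obtains n and \<psi> :: "nat \<Rightarrow> real^2 \<Rightarrow> real" where "\<And>k. linear (\<psi> k)"
    and "\<And>y. (\<Sum>k<n. \<bar>\<psi> k y\<bar>) \<le> N y" and "\<And>v. v \<in> V \<Longrightarrow> (\<Sum>k<n. \<bar>\<psi> k v\<bar>) = N v"
proof -
  \<comment> \<open>The coordinate \<open>X\<close> vanishes on no nonzero element of \<open>V\<close>, so each of these has a slope, and \<open>dir r\<close>
    is the vector of slope \<open>r\<close> with \<open>X\<close>-coordinate 1.\<close>
  have "finite ((\<lambda>v::real^2. - v$1 / v$2) ` V)" using fin by simp
  then obtain c where c: "c \<notin> (\<lambda>v::real^2. - v$1 / v$2) ` V"
    using ex_new_if_finite[OF infinite_UNIV_char_0] by blast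
  define X where "X v = v$1 + c * v$2" for v :: "real^2"
  define dir where "dir r = (vector [1 - c * r, r] :: real^2)" for r
  have X0: "X v \<noteq> 0" if v: "v \<in> V" "v \<noteq> 0" for v
  proof
    assume 0: "X v = 0"
    then have "v$2 \<noteq> 0" using v by (auto simp: X_def vec_eq_iff forall_2)
    then have "c = - v$1 / v$2" using 0 by (simp add: X_def field_simps)
    then show False using c v by blast
  qed
  have X_dir: "X (dir r) = 1" for r by (simp add: X_def dir_def)
  have dir0: "dir r \<noteq> 0" for r using X_dir[of r] by (auto simp: X_def)
  have dir_slope: "v = X v *\<^sub>R dir (v$2 / X v)" if "X v \<noteq> 0" for v
    using that by (simp add: vec_eq_iff forall_2 dir_def field_simps) (simp add: X_def algebra_simps)
  have coord: "\<delta> y = X y * \<delta> (dir 0) + y$2 * \<delta> (dir 1 - dir 0)" if "linear \<delta>" for \<delta> :: "real^2 \<Rightarrow> real" and y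
  proof -
    have "y = X y *\<^sub>R dir 0 + y$2 *\<^sub>R (dir 1 - dir 0)"
      by (simp add: vec_eq_iff forall_2 dir_def X_def)
    then have "\<delta> y = \<delta> (X y *\<^sub>R dir 0 + y$2 *\<^sub>R (dir 1 - dir 0))" by simp
    then show ?thesis by (simp only: linear_add[OF that] linear_scale[OF that] real_scaleR_def)
  qed
  define S where "S = (\<lambda>v. v$2 / X v) ` (V - {0})"
  define xs where "xs = sorted_list_of_set S"
  define n where "n = length xs"
  define s where "s k = xs ! k" for k
  have "finite S" using fin by (simp add: S_def)
  then have "S = set xs" by (simp add: xs_def)
  also have "\<dots> = s ` {..<n}" by (auto simp: set_conv_nth s_def n_def)
  finally have set_xs: "S = s ` {..<n}" .
  have s_less: "s i < s j" if "i < j" "j < n" for i j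
    using that sorted_wrt_nth_less[OF strict_sorted_list_of_set[of S]] by (simp add: xs_def n_def s_def)
  have s_le: "s i \<le> s j" if "i \<le> j" "j < n" for i j
    using s_less[of i j] that by (cases "i = j") auto
  have "\<forall>r. \<exists>\<phi>. linear \<phi> \<and> \<phi> (dir r) = N (dir r) \<and> (\<forall>z. \<phi> z \<le> N z)"
    using norming_functional[OF dir0] by metis
  then obtain \<Phi> where \<Phi>: "\<And>r. linear (\<Phi> r)" "\<And>r. \<Phi> r (dir r) = N (dir r)" "\<And>r z. \<Phi> r z \<le> N z"
    by metis
  show thesis
  proof (cases "n = 0")
    case True
    then have "S = {}" using set_xs by simp
    then have "V \<subseteq> {0}" by (auto simp: S_def)
    then show thesis
      by (intro that[of "\<lambda>_ _. 0" 0]) (auto intro: linear_zero)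
  next
    case False
    define \<phi> where "\<phi> k z = (if k < n then \<Phi> (s k) z else - \<Phi> (s 0) z)" for k z
    have lin: "linear (\<phi> k)" for k
      using \<Phi>(1) linear_compose_neg[OF \<Phi>(1)] unfolding \<phi>_def by (cases "k < n") auto
    have le: "\<phi> k z \<le> N z" for k z
      using \<Phi>(3)[of "s k" z] \<Phi>(3)[of "s 0" "- z"] by (simp add: \<phi>_def linear_neg[OF \<Phi>(1)])
    have norming: "\<phi> k (dir (s k)) = N (dir (s k))" if "k < n" for k
      using that \<Phi>(2) by (simp add: \<phi>_def)
    have wrap: "\<phi> n z = - \<phi> 0 z" for z using False by (simp add: \<phi>_def)
    define \<delta> where "\<delta> k z = \<phi> (Suc k) z - \<phi> k z" for k z
    have lin\<delta>: "linear (\<delta> k)" for k unfolding \<delta>_def by (intro linear_compose_sub lin)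
    have \<delta>_minus: "\<delta> k (- z) = - \<delta> k z" for k z by (rule linear_neg[OF lin\<delta>])
    have \<delta>_left: "\<delta> k (dir (s k)) \<le> 0" if "k < n" for k
      using le[of "Suc k"] norming[OF that] by (simp add: \<delta>_def)
    have \<delta>_right: "0 \<le> \<delta> k (dir (s (Suc k)))" if "Suc k < n" for k
      using le[of k] norming[OF that] by (simp add: \<delta>_def)
    have \<delta>_last: "\<delta> (n - 1) (dir (s 0)) \<le> 0"
      using le[of "n - 1" "- dir (s 0)"] norming[of 0] wrap False
      by (simp add: \<delta>_def linear_neg[OF lin])
    define b m where "b k = \<delta> k (dir 0)" and "m k = \<delta> k (dir 1 - dir 0)" for k
    have \<delta>_eq: "\<delta> k y = X y * b k + y$2 * m k" for k y
      unfolding b_def m_def by (rule coord[OF lin\<delta>])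
    have \<delta>_dir: "\<delta> k (dir r) = b k + r * m k" for k r
      using \<delta>_eq[of k "dir r"] X_dir[of r] by (simp add: dir_def)
    have m_nonneg: "0 \<le> m k" if "Suc k < n" for k
    proof -
      have "0 \<le> (s (Suc k) - s k) * m k"
        using \<delta>_left[of k] \<delta>_right[of k] that by (simp add: \<delta>_dir algebra_simps)
      then show ?thesis using s_less[of k "Suc k"] that by (simp add: zero_le_mult_iff)
    qed
    \<comment> \<open>Hence \<open>\<delta> k\<close> passes from nonpositive to nonnegative values between the slopes \<open>s k\<close> and \<open>s (Suc k)\<close>.\<close>
    have above: "0 \<le> \<delta> k y" if "Suc k < n" "0 \<le> X y" "X y * s (Suc k) \<le> y$2" for k y
    proof -
      have "0 \<le> X y * (b k + s (Suc k) * m k)"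
        using \<delta>_right[OF that(1)] that(2) by (simp add: \<delta>_dir)
      also have "\<dots> = X y * b k + (X y * s (Suc k)) * m k" by (simp add: algebra_simps)
      also have "\<dots> \<le> X y * b k + y$2 * m k"
        using that m_nonneg[of k] by (intro add_left_mono mult_right_mono) auto
      finally show ?thesis by (simp add: \<delta>_eq)
    qed
    have below: "\<delta> k y \<le> 0" if "Suc k < n" "0 \<le> X y" "y$2 \<le> X y * s k" for k y
    proof -
      have "X y * b k + y$2 * m k \<le> X y * b k + (X y * s k) * m k"
        using that m_nonneg[of k] by (intro add_left_mono mult_right_mono) auto
      also have "\<dots> = X y * (b k + s k * m k)" by (simp add: algebra_simps)
      also have "\<dots> \<le> 0"
        using \<delta>_left[of k] that by (simp add: \<delta>_dir mult_nonneg_nonpos)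
      finally show ?thesis by (simp add: \<delta>_eq)
    qed
    \<comment> \<open>The closing difference is different: it is nonpositive between the first and the last slope.\<close>
    have last: "\<delta> (n - 1) y \<le> 0" if "0 \<le> X y" "X y * s 0 \<le> y$2" "y$2 \<le> X y * s (n - 1)" for y
    proof (cases "0 \<le> m (n - 1)")
      case True
      have "X y * b (n - 1) + y$2 * m (n - 1) \<le> X y * b (n - 1) + (X y * s (n - 1)) * m (n - 1)"
        using that True by (intro add_left_mono mult_right_mono) auto
      also have "\<dots> = X y * (b (n - 1) + s (n - 1) * m (n - 1))" by (simp add: algebra_simps)
      also have "\<dots> \<le> 0"
        using \<delta>_left[of "n - 1"] that False by (simp add: \<delta>_dir mult_nonneg_nonpos)
      finally show ?thesis by (simp add: \<delta>_eq)
    next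
      case neg: False
      have "X y * b (n - 1) + y$2 * m (n - 1) \<le> X y * b (n - 1) + (X y * s 0) * m (n - 1)"
        using that neg by (intro add_left_mono mult_right_mono_neg) auto
      also have "\<dots> = X y * (b (n - 1) + s 0 * m (n - 1))" by (simp add: algebra_simps)
      also have "\<dots> \<le> 0"
        using \<delta>_last that by (simp add: \<delta>_dir mult_nonneg_nonpos)
      finally show ?thesis by (simp add: \<delta>_eq)
    qed
    have bound_if: "(\<Sum>k<n. \<bar>\<delta> k y\<bar>) \<le> 2 * N y"
      if "\<And>k l. k < l \<Longrightarrow> l < n \<Longrightarrow> \<delta> k y < 0 \<Longrightarrow> \<delta> l y \<le> 0" for y
      using unimodal_variation_le[of n "\<lambda>k. \<phi> k y" "N y"] that le wrap[of y]
      by (simp add: \<delta>_def)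
    have bound_pos: "(\<Sum>k<n. \<bar>\<delta> k y\<bar>) \<le> 2 * N y" if y: "0 \<le> X y" for y
    proof -
      consider "X y * s (n - 1) \<le> y$2" | "y$2 \<le> X y * s 0"
        | "X y * s 0 \<le> y$2" "y$2 \<le> X y * s (n - 1)" by linarith
      then show ?thesis
      proof cases
        case 1
        have "0 \<le> \<delta> k y" if "Suc k < n" for k
        proof -
          have "X y * s (Suc k) \<le> X y * s (n - 1)"
            using that y by (intro mult_left_mono s_le) auto
          then show ?thesis using above[OF that y] 1 by simp
        qed
        then show ?thesis by (intro bound_if) (meson Suc_leI le_less_trans not_le)
      next
        case 2
        have "\<delta> k y \<le> 0" if "Suc k < n" for k
        proof -
          have "X y * s 0 \<le> X y * s k" using that y by (intro mult_left_mono s_le) auto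
          then show ?thesis using below[OF that y] 2 by simp
        qed
        then have "(\<Sum>k<n. \<bar>\<delta> k (- y)\<bar>) \<le> 2 * N (- y)"
          by (intro bound_if) (metis Suc_leI \<delta>_minus le_less_trans neg_less_0_iff_less not_le)
        then show ?thesis by (simp add: \<delta>_minus)
      next
        case 3
        show ?thesis
        proof (rule bound_if)
          fix k l assume kl: "k < l" "l < n" and neg: "\<delta> k y < 0"
          show "\<delta> l y \<le> 0"
          proof (cases "Suc l < n")
            case True
            have "y$2 \<le> X y * s (Suc k)" using above[of k y] neg kl y by linarith
            also have "\<dots> \<le> X y * s l" using kl y by (intro mult_left_mono s_le) auto
            finally show ?thesis using below[OF True y] by simp
          next
            case False
            then have "l = n - 1" using kl by simp
            then show ?thesis using last[OF y 3] by simp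
          qed
        qed
      qed
    qed
    have bound: "(\<Sum>k<n. \<bar>\<delta> k y\<bar>) \<le> 2 * N y" for y
    proof (cases "0 \<le> X y")
      case False
      then have "0 \<le> X (- y)" by (simp add: X_def)
      then show ?thesis using bound_pos[of "- y"] by (simp add: \<delta>_minus)
    qed (rule bound_pos)
    have attained_dir: "2 * N (dir (s j)) \<le> (\<Sum>k<n. \<bar>\<delta> k (dir (s j))\<bar>)" if j: "j < n" for j
    proof -
      define V where "V i k = (\<Sum>l=i..<k. \<bar>\<delta> l (dir (s j))\<bar>)" for i k
      have V: "\<bar>\<phi> k (dir (s j)) - \<phi> i (dir (s j))\<bar> \<le> V i k" if "i \<le> k" for i k
        using abs_diff_le_variation[OF that, of "\<lambda>k. \<phi> k (dir (s j))"] by (simp add: V_def \<delta>_def)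
      have "V 0 n = V 0 j + V j n"
        using j by (simp add: V_def sum.atLeastLessThan_concat)
      then have "2 * N (dir (s j)) \<le> V 0 n"
        using V[of 0 j] V[of j n] wrap[of "dir (s j)"] norming[OF j] j by simp
      then show ?thesis by (simp add: V_def atLeast0LessThan)
    qed
    have attained: "2 * N v \<le> (\<Sum>k<n. \<bar>\<delta> k v\<bar>)" if v: "v \<in> V" for v
    proof (cases "v = 0")
      case True
      then show ?thesis by (simp add: sum_nonneg)
    next
      case False
      have "v$2 / X v \<in> S" using v False by (auto simp: S_def)
      then obtain j where j: "j < n" "v$2 / X v = s j" using set_xs by auto
      have veq: "v = X v *\<^sub>R dir (s j)" using dir_slope[OF X0[OF v False]] j(2) by simp
      have "2 * N v = \<bar>X v\<bar> * (2 * N (dir (s j)))" by (subst veq) (simp only: N_scale mult_ac)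
      also have "\<dots> \<le> \<bar>X v\<bar> * (\<Sum>k<n. \<bar>\<delta> k (dir (s j))\<bar>)"
        by (intro mult_left_mono attained_dir j) simp
      also have "\<dots> = (\<Sum>k<n. \<bar>\<delta> k (X v *\<^sub>R dir (s j))\<bar>)"
        by (simp add: sum_distrib_left linear_scale[OF lin\<delta>] abs_mult)
      finally show ?thesis using veq by simp
    qed
    define \<psi> where "\<psi> k z = (1/2) * \<delta> k z" for k z
    have half: "(\<Sum>k<n. \<bar>\<psi> k z\<bar>) = (1/2) * (\<Sum>k<n. \<bar>\<delta> k z\<bar>)" for z
      by (simp add: \<psi>_def sum_distrib_left abs_mult)
    show thesis
    proof (rule that[of \<psi> n])
      show "linear (\<psi> k)" for k
        unfolding \<psi>_def using linear_compose_scale_right[OF lin\<delta>, of "1/2" k] by simp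
      show "(\<Sum>k<n. \<bar>\<psi> k y\<bar>) \<le> N y" for y using bound[of y] by (simp add: half)
      show "(\<Sum>k<n. \<bar>\<psi> k v\<bar>) = N v" if "v \<in> V" for v
        using bound[of v] attained[OF that] by (simp add: half)
    qed
  qed
qed

end

section \<open>Perimeter and widths\<close>

lemma subdivision_through:
  assumes fin: "finite A" and sub: "A \<subseteq> {0..1}"
  obtains n t where "subdivision n t" and "A \<subseteq> t ` {..n}"
proof -
  define B where "B = insert 0 (insert 1 A)"
  define xs where "xs = sorted_list_of_set B"
  define n where "n = length xs - 1"
  have finB: "finite B" using fin by (simp add: B_def)
  have set_xs: "set xs = B" using finB by (simp add: xs_def)
  have len: "length xs = Suc n" using set_xs by (cases xs) (auto simp: n_def B_def)
  have B01: "B \<subseteq> {0..1}" using sub by (auto simp: B_def)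
  have less: "xs ! i < xs ! j" if "i < j" "j \<le> n" for i j
    using that len sorted_wrt_nth_less[OF strict_sorted_list_of_set[of B]] by (simp add: xs_def)
  then have le: "xs ! i \<le> xs ! j" if "i \<le> j" "j \<le> n" for i j
    using that by (cases "i = j") (auto intro: less_imp_le)
  have index: "\<exists>i\<le>n. x = xs ! i" if "x \<in> B" for x
    using that len by (auto simp: set_xs[symmetric] in_set_conv_nth less_Suc_eq_le)
  have mem: "xs ! i \<in> {0..1}" if "i \<le> n" for i
    using that len set_xs B01 nth_mem[of i xs] by auto
  obtain i0 i1 where i: "i0 \<le> n" "0 = xs ! i0" "i1 \<le> n" "1 = xs ! i1"
    using index[of 0] index[of 1] by (auto simp: B_def)
  have "xs ! 0 = 0" using le[of 0 i0] i mem[of 0] by auto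
  moreover have "xs ! n = 1" using le[of i1 n] i mem[of n] by auto
  ultimately have "subdivision n ((!) xs)"
    using less by (simp add: subdivision_def)
  moreover have "A \<subseteq> (!) xs ` {..n}" using index by (auto simp: B_def)
  ultimately show thesis by (rule that)
qed

text \<open>A closed curve goes from \<open>g (\<beta> k)\<close> to \<open>g (\<alpha> k)\<close> and back, and so varies under \<open>\<psi> k\<close> by at
  least twice the difference. One subdivision can visit all these points, in whatever order, and the
  sum of the variations is bounded by the length of the inscribed polygon.\<close>
lemma arclength_ge_widths:
  fixes g :: "real \<Rightarrow> 'a::real_vector" and \<psi> :: "nat \<Rightarrow> 'a \<Rightarrow> real"
  assumes closed: "g 1 = g 0" and lin: "\<And>k. linear (\<psi> k)"
    and le: "\<And>y. (\<Sum>k<n. \<bar>\<psi> k y\<bar>) \<le> mnorm M y"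
    and times: "\<And>k. k < n \<Longrightarrow> \<alpha> k \<in> {0..1}" "\<And>k. k < n \<Longrightarrow> \<beta> k \<in> {0..1}"
  shows "ereal (2 * (\<Sum>k<n. \<psi> k (g (\<alpha> k) - g (\<beta> k)))) \<le> arclength M g"
proof -
  obtain l t where t: "subdivision l t" and visit: "\<alpha> ` {..<n} \<union> \<beta> ` {..<n} \<subseteq> t ` {..l}"
    using subdivision_through[of "\<alpha> ` {..<n} \<union> \<beta> ` {..<n}"] times by (auto simp: image_subset_iff)
  have ends: "g (t l) = g (t 0)" using t closed by (simp add: subdivision_def)
  have each: "2 * \<psi> k (g (\<alpha> k) - g (\<beta> k)) \<le> (\<Sum>i<l. \<bar>\<psi> k (g (t (Suc i)) - g (t i))\<bar>)" if k: "k < n" for k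
  proof -
    obtain i j where ij: "i \<le> l" "\<alpha> k = t i" "j \<le> l" "\<beta> k = t j"
      using visit k by (force simp: image_subset_iff)
    have "2 * \<bar>\<psi> k (g (t i)) - \<psi> k (g (t j))\<bar> \<le> (\<Sum>i<l. \<bar>\<psi> k (g (t (Suc i))) - \<psi> k (g (t i))\<bar>)"
      using ends ij by (intro closed_variation_ge) simp_all
    moreover have "2 * (\<psi> k (g (t i)) - \<psi> k (g (t j))) \<le> 2 * \<bar>\<psi> k (g (t i)) - \<psi> k (g (t j))\<bar>"
      by (intro mult_left_mono abs_ge_self) simp
    ultimately show ?thesis unfolding ij linear_diff[OF lin] by (rule order_trans[rotated])
  qed
  have "2 * (\<Sum>k<n. \<psi> k (g (\<alpha> k) - g (\<beta> k))) \<le> (\<Sum>k<n. \<Sum>i<l. \<bar>\<psi> k (g (t (Suc i)) - g (t i))\<bar>)"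
    unfolding sum_distrib_left using each by (intro sum_mono) simp
  also have "\<dots> = (\<Sum>i<l. \<Sum>k<n. \<bar>\<psi> k (g (t (Suc i)) - g (t i))\<bar>)" by (rule sum.swap)
  also have "\<dots> \<le> (\<Sum>i<l. mnorm M (g (t (Suc i)) - g (t i)))" by (intro sum_mono le)
  also have "\<dots> = (\<Sum>i=1..l. mnorm M (g (t i) - g (t (i - 1))))"
    by (rule sum.reindex_bij_witness[of _ "\<lambda>i. i - 1" Suc]) auto
  finally have "ereal (2 * (\<Sum>k<n. \<psi> k (g (\<alpha> k) - g (\<beta> k))))
      \<le> ereal (\<Sum>i=1..l. mnorm M (g (t i) - g (t (i - 1))))" by simp
  also have "\<dots> \<le> arclength M g"
    unfolding arclength_def using t by (intro SUP_upper2[of "(l, t)"]) auto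
  finally show ?thesis .
qed

lemma frontier_point_above:
  fixes K :: "'a::euclidean_space set" and \<psi> :: "'a \<Rightarrow> real"
  assumes K: "compact K" and a: "a \<in> K" and lin: "linear \<psi>"
  obtains b where "b \<in> frontier K" "\<psi> a \<le> \<psi> b"
proof (cases "a \<in> interior K")
  case True
  obtain d :: 'a where "d \<noteq> 0" by (metis nonzero_Basis SOME_Basis)
  define l where "l = (if 0 \<le> \<psi> d then d else - d)"
  have l: "l \<noteq> 0" "0 \<le> \<psi> l" using \<open>d \<noteq> 0\<close> by (auto simp: l_def linear_neg[OF lin])
  obtain s where s: "0 < s" "a + s *\<^sub>R l \<in> frontier K"
    using ray_to_frontier[OF compact_imp_bounded[OF K] True l(1)] by blast
  show thesis
    using that[OF s(2)] s(1) l(2) by (simp add: linear_add[OF lin] linear_scale[OF lin])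
next
  case False
  then have "a \<in> frontier K" using a closure_subset[of K] by (auto simp: frontier_def)
  then show thesis using that by blast
qed

text \<open>Points of \<open>K\<close> can be replaced by boundary points with larger, respectively smaller, values. As only
  the set of points of the boundary curve matters, the estimate holds for every parametrization.\<close>
lemma widths_le_perim:
  fixes K :: "(real^2) set" and \<psi> :: "nat \<Rightarrow> real^2 \<Rightarrow> real"
  assumes K: "convex_body K" and lin: "\<And>k. linear (\<psi> k)"
    and le: "\<And>y. (\<Sum>k<n. \<bar>\<psi> k y\<bar>) \<le> mnorm M y"
    and ab: "\<And>k. k < n \<Longrightarrow> a k \<in> K" "\<And>k. k < n \<Longrightarrow> b k \<in> K"
  shows "ereal (2 * (\<Sum>k<n. \<psi> k (a k - b k))) \<le> perim M K"
proof -
  define g where "g = (SOME g. boundary_curve K g)"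
  have "boundary_curve K g"
    unfolding g_def using boundary_curve_exists[OF K] by (rule someI_ex)
  then have closed: "g 1 = g 0" and image: "g ` {0..1} = frontier K"
    by (auto simp: boundary_curve_def pathfinish_def pathstart_def path_image_def)
  have cK: "compact K" using K by (simp add: convex_body_def)
  have "\<exists>\<alpha>\<in>{0..1}. \<phi> x \<le> \<phi> (g \<alpha>)" if "x \<in> K" "linear \<phi>" for x and \<phi> :: "real^2 \<Rightarrow> real"
    using frontier_point_above[OF cK that] image by (metis imageE)
  then have "\<forall>k. \<exists>\<alpha>. k < n \<longrightarrow> \<alpha> \<in> {0..1} \<and> \<psi> k (a k) \<le> \<psi> k (g \<alpha>)"
    and "\<forall>k. \<exists>\<beta>. k < n \<longrightarrow> \<beta> \<in> {0..1} \<and> - \<psi> k (b k) \<le> - \<psi> k (g \<beta>)"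
    using ab lin linear_compose_neg[OF lin] by meson+
  then obtain \<alpha> \<beta> where
    \<alpha>: "\<And>k. k < n \<Longrightarrow> \<alpha> k \<in> {0..1}" "\<And>k. k < n \<Longrightarrow> \<psi> k (a k) \<le> \<psi> k (g (\<alpha> k))" and
    \<beta>: "\<And>k. k < n \<Longrightarrow> \<beta> k \<in> {0..1}" "\<And>k. k < n \<Longrightarrow> \<psi> k (g (\<beta> k)) \<le> \<psi> k (b k)"
    by (metis neg_le_iff_le)
  have "(\<Sum>k<n. \<psi> k (a k - b k)) \<le> (\<Sum>k<n. \<psi> k (g (\<alpha> k) - g (\<beta> k)))"
    using \<alpha>(2) \<beta>(2) by (intro sum_mono) (simp add: linear_diff[OF lin] diff_mono)
  then have "ereal (2 * (\<Sum>k<n. \<psi> k (a k - b k))) \<le> ereal (2 * (\<Sum>k<n. \<psi> k (g (\<alpha> k) - g (\<beta> k))))"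
    by simp
  also have "\<dots> \<le> arclength M g"
    by (rule arclength_ge_widths[OF closed lin le \<alpha>(1) \<beta>(1)])
  finally show ?thesis by (simp add: perim_def g_def)
qed

context unit_increasing_chord_curve
begin

section \<open>The bound on the arclength\<close>

text \<open>Collect in \<open>x\<close> the edges on which \<open>\<psi>\<close> is nonnegative; the other edges sum to \<open>e - x\<close>.\<close>
lemma variation_by_rise:
  fixes \<psi> :: "real^2 \<Rightarrow> real"
  assumes lin: "linear \<psi>" and t: "subdivision n t"
  obtains x where "x \<in> rise_set n" "(\<Sum>i<n. \<bar>\<psi> (f (t (Suc i)) - f (t i))\<bar>) = \<psi> (2 *\<^sub>R x - e)"
proof -
  have ends: "t 0 = 0" "t n = 1" using t by (auto simp: subdivision_def)
  have mono: "t i \<le> t j" if "i \<le> j" "j \<le> n" for i j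
    using that
  proof (induction j rule: dec_induct)
    case (step k)
    then have "t i \<le> t k" by simp
    also have "t k < t (Suc k)" using step t by (simp add: subdivision_def)
    finally show ?case by simp
  qed simp
  define c where "c i = t (min i n)" for i
  have c: "c i \<le> c j" if "i \<le> j" for i j
    using that by (auto simp: c_def intro: mono)
  have c01: "0 \<le> c i" "c i \<le> 1" for i
    using mono[of 0 "min i n"] mono[of "min i n" n] ends by (auto simp: c_def)
  \<comment> \<open>On an edge that is not to be collected, the interval shrinks to its left end point.\<close>
  define up where "up i \<longleftrightarrow> 0 \<le> \<psi> (f (t (Suc i)) - f (t i))" for i
  define s where "s k = (if even k then c (k div 2) else if up (k div 2) then c (Suc (k div 2)) else c (k div 2))" for k
  have "s \<in> schedules"
    by (rule schedulesI) (auto simp: s_def c c01 elim!: evenE oddE)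
  moreover have "rises f n s = (\<Sum>i<n. if up i then f (t (Suc i)) - f (t i) else 0)"
    unfolding rises_def by (intro sum.cong) (auto simp: s_def c_def min_def)
  ultimately have x: "(\<Sum>i<n. if up i then f (t (Suc i)) - f (t i) else 0) \<in> rise_set n" (is "?x \<in> _")
    unfolding rise_set_def by (rule subst[where P = "\<lambda>y. y \<in> rises f n ` schedules", OF _ imageI, rotated])
  have e_sum: "e = (\<Sum>i<n. f (t (Suc i)) - f (t i))"
    using sum_lessThan_telescope[of "\<lambda>i. f (t i)" n] ends by (simp add: e_eq)
  have "\<psi> (2 *\<^sub>R ?x - e) = (\<Sum>i<n. 2 * \<psi> (if up i then f (t (Suc i)) - f (t i) else 0) - \<psi> (f (t (Suc i)) - f (t i)))"
    by (simp only: e_sum linear_diff[OF lin] linear_scale[OF lin] linear_sum[OF lin] real_scaleR_def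
        sum_distrib_left sum_subtractf)
  also have "\<dots> = (\<Sum>i<n. \<bar>\<psi> (f (t (Suc i)) - f (t i))\<bar>)"
    by (intro sum.cong) (auto simp: up_def linear_0[OF lin])
  finally show thesis using that[OF x] by simp
qed

end

lemma mnorm_le_1_iff:
  assumes "convex_body M" "origin_symmetric M"
  shows "mnorm M x \<le> 1 \<longleftrightarrow> x \<in> M"
  using mnorm_le_iff[OF assms, of 1 x] by simp

lemma mnorm_less_1_interior:
  fixes x :: "'a::euclidean_space"
  assumes M: "convex_body M" "origin_symmetric M" and x: "x \<in> interior M"
  shows "mnorm M x < 1"
proof -
  obtain d where d: "0 < d" "cball x d \<subseteq> M"
    using x mem_interior_cball by blast
  define c where "c = 1 + d / (norm x + 1)"
  have pos: "0 < norm x + 1" by (simp add: add_nonneg_pos)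
  have c: "1 < c" using d(1) pos by (simp add: c_def)
  have "dist x (c *\<^sub>R x) = d * (norm x / (norm x + 1))"
    using d(1) pos by (simp add: c_def dist_norm algebra_simps norm_minus_commute)
  also have "\<dots> \<le> d" using d(1) pos by (intro mult_left_le) auto
  finally have "c *\<^sub>R x \<in> M" using d(2) by auto
  then have "mnorm M (c *\<^sub>R x) \<le> 1" by (simp add: mnorm_le_1_iff[OF M])
  then have "c * mnorm M x \<le> 1" using c by (simp add: mnorm_scaleR[OF M])
  moreover have "mnorm M x < c * mnorm M x" if "1 \<le> mnorm M x" using c that by simp
  ultimately show ?thesis by linarith
qed

lemma strictly_convex_norm_mnorm:
  fixes M :: "(real^2) set"
  assumes M: "convex_body M" "origin_symmetric M" and strict: "strictly_convex M"
  shows "strictly_convex_norm (mnorm M)"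
proof
  show "mnorm M x = 0 \<longleftrightarrow> x = 0" for x by (rule mnorm_eq_0_iff[OF M])
  show "mnorm M (c *\<^sub>R x) = \<bar>c\<bar> * mnorm M x" for c x by (rule mnorm_scaleR[OF M])
  show "mnorm M (x + y) \<le> mnorm M x + mnorm M y" for x y by (rule mnorm_triangle[OF M])
  fix x y assume "mnorm M x \<le> 1" "mnorm M y \<le> 1" "x \<noteq> y"
  then have "open_segment x y \<subseteq> interior M"
    using strict unfolding strictly_convex_def mnorm_le_1_iff[OF M] by blast
  then have "midpoint x y \<in> interior M" using \<open>x \<noteq> y\<close> by auto
  then have "mnorm M ((1/2) *\<^sub>R (x + y)) < 1"
    using mnorm_less_1_interior[OF M] by (simp add: midpoint_def)
  then show "mnorm M (x + y) < 2" by (simp add: mnorm_scaleR[OF M])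
qed

lemma convex_body_lens:
  fixes M :: "'a::euclidean_space set"
  assumes M: "convex_body M" "origin_symmetric M" and pq: "mnorm M (p - q) \<le> 1"
  shows "convex_body ((\<lambda>x. p + x) ` M \<inter> (\<lambda>x. q + x) ` M)"
proof -
  have cM: "compact M" "convex M" using M by (auto simp: convex_body_def)
  have minus_half: "x - (1/2) *\<^sub>R x = (1/2) *\<^sub>R x" for x :: 'a
    using scaleR_left_diff_distrib[of 1 "1/2" x] by simp
  have half: "(1/2) *\<^sub>R y \<in> interior M" if "y \<in> M" for y
  proof -
    have "y - (1/2) *\<^sub>R (y - 0) \<in> interior M"
      using mem_interior_convex_shrink[OF cM(2) convex_body_0_interior[OF M] that, of "1/2"] by simp
    then show ?thesis by (simp add: minus_half)
  qed
  have "p - q \<in> M" using pq by (simp add: mnorm_le_1_iff[OF M])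
  moreover from this have "q - p \<in> M" using origin_symmetric_minus[OF M(2), of "p - q"] by simp
  ultimately have "(1/2) *\<^sub>R (q - p) \<in> interior M" "(1/2) *\<^sub>R (p - q) \<in> interior M"
    by (auto intro: half)
  moreover have "midpoint p q = p + (1/2) *\<^sub>R (q - p)" "midpoint p q = q + (1/2) *\<^sub>R (p - q)"
    using minus_half[of p] minus_half[of q]
    by (simp_all add: midpoint_def algebra_simps)
  ultimately have "midpoint p q \<in> interior ((\<lambda>x. p + x) ` M \<inter> (\<lambda>x. q + x) ` M)"
    unfolding interior_Int interior_translation by (metis IntI imageI)
  moreover have "compact ((\<lambda>x. p + x) ` M \<inter> (\<lambda>x. q + x) ` M)"
    using cM by (intro compact_Int compact_translation)
  moreover have "convex ((\<lambda>x. p + x) ` M \<inter> (\<lambda>x. q + x) ` M)"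
    using cM by (intro convex_Int convex_translation)
  ultimately show ?thesis unfolding convex_body_def by blast
qed

theorem theorem1:
  fixes M :: "(real^2) set" and p q :: "real^2" and f :: "real \<Rightarrow> real^2"
  assumes "convex_body M"
    and "origin_symmetric M"
    and "strictly_convex M"
    and "mnorm M (p - q) = 1"
    and "continuous_on {0..1} f"
    and "increasing_chord M f"
    and "f 0 = p"
    and "f 1 = q"
  shows "arclength M f \<le> 1 / 2 * perim M ((\<lambda>x. p + x) ` M \<inter> (\<lambda>x. q + x) ` M)"
proof -
  note M = assms(1,2)
  let ?K = "(\<lambda>x. p + x) ` M \<inter> (\<lambda>x. q + x) ` M"
  have Npq: "mnorm M (q - p) = 1"
    using mnorm_minus[OF M(2), of "p - q"] assms(4) by simp
  interpret strictly_convex_norm "mnorm M"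
    by (rule strictly_convex_norm_mnorm[OF assms(1-3)])
  interpret unit_increasing_chord_curve "mnorm M" f "q - p"
    using assms(5-8) Npq by unfold_locales (auto simp: increasing_chord_def)
  have K: "convex_body ?K" using assms(4) by (intro convex_body_lens M) simp
  have in_K: "p + x \<in> ?K" if x: "x \<in> rise_set n" for x n
  proof -
    have "x \<in> M" using N_rise_le_1[OF x] by (simp add: mnorm_le_1_iff[OF M])
    moreover have "q - p - x \<in> M"
      using N_rise_le_1[OF e_minus_rise[OF x]] by (simp add: mnorm_le_1_iff[OF M])
    then have "p + x - q \<in> M"
      using origin_symmetric_minus[OF M(2), of "q - p - x"] by (simp add: algebra_simps)
    then have "q + (p + x - q) \<in> (\<lambda>x. q + x) ` M" by (rule imageI)
    ultimately show ?thesis by auto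
  qed
  have "ereal (\<Sum>i=1..n. mnorm M (f (t i) - f (t (i - 1)))) \<le> 1 / 2 * perim M ?K"
    if t: "subdivision n t" for n t
  proof -
    define v where "v i = f (t (Suc i)) - f (t i)" for i
    obtain m and \<psi> :: "nat \<Rightarrow> real^2 \<Rightarrow> real" where lin: "\<And>k. linear (\<psi> k)" and le: "\<And>y. (\<Sum>k<m. \<bar>\<psi> k y\<bar>) \<le> mnorm M y"
      and eq: "\<And>y. y \<in> v ` {..<n} \<Longrightarrow> (\<Sum>k<m. \<bar>\<psi> k y\<bar>) = mnorm M y"
      by (rule finite_Crofton[of "v ` {..<n}"], simp, rule that)
    have "\<exists>x. x \<in> rise_set n \<and> (\<Sum>i<n. \<bar>\<psi> k (v i)\<bar>) = \<psi> k (2 *\<^sub>R x - (q - p))" for k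
    proof -
      obtain x where "x \<in> rise_set n" "(\<Sum>i<n. \<bar>\<psi> k (v i)\<bar>) = \<psi> k (2 *\<^sub>R x - (q - p))"
        unfolding v_def by (rule variation_by_rise[OF lin t])
      then show ?thesis by blast
    qed
    then have "\<exists>x. \<forall>k. x k \<in> rise_set n \<and> (\<Sum>i<n. \<bar>\<psi> k (v i)\<bar>) = \<psi> k (2 *\<^sub>R x k - (q - p))"
      by (intro choice allI)
    then obtain x where x: "\<And>k. x k \<in> rise_set n"
      and var: "\<And>k. (\<Sum>i<n. \<bar>\<psi> k (v i)\<bar>) = \<psi> k (2 *\<^sub>R x k - (q - p))" by blast
    have "(\<Sum>i=1..n. mnorm M (f (t i) - f (t (i - 1)))) = (\<Sum>i<n. mnorm M (v i))"
      unfolding v_def by (rule sum.reindex_bij_witness[of _ Suc "\<lambda>i. i - 1"]) auto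
    also have "\<dots> = (\<Sum>i<n. \<Sum>k<m. \<bar>\<psi> k (v i)\<bar>)" using eq by (intro sum.cong) auto
    also have "\<dots> = (\<Sum>k<m. \<psi> k (2 *\<^sub>R x k - (q - p)))" by (subst sum.swap) (simp add: var)
    also have "\<dots> = (\<Sum>k<m. \<psi> k ((p + x k) - (p + (q - p - x k))))"
      by (simp add: scaleR_2 algebra_simps)
    finally have len: "(\<Sum>i=1..n. mnorm M (f (t i) - f (t (i - 1))))
        = (\<Sum>k<m. \<psi> k ((p + x k) - (p + (q - p - x k))))" .
    have "ereal (2 * (\<Sum>k<m. \<psi> k ((p + x k) - (p + (q - p - x k))))) \<le> perim M ?K"
      by (rule widths_le_perim[OF K lin le in_K[OF x] in_K[OF e_minus_rise[OF x]]])
    then have "ereal (2 * (\<Sum>i=1..n. mnorm M (f (t i) - f (t (i - 1))))) \<le> perim M ?K"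
      by (simp only: len)
    then have "ereal (1/2) * ereal (2 * (\<Sum>i=1..n. mnorm M (f (t i) - f (t (i - 1))))) \<le> ereal (1/2) * perim M ?K"
      by (intro ereal_mult_left_mono) auto
    moreover have "ereal (1/2) = 1 / 2" by (simp add: divide_ereal_def one_ereal_def)
    ultimately show ?thesis by simp
  qed
  then show ?thesis unfolding arclength_def by (auto intro!: SUP_least)
qed

end
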